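(* Let $\mathbb F$ be any field, let $n,k$ be positive integers with $n \ge k+2$, and let $\mathcal K \subseteq M_{n\times k}(\mathbb F)$ be a linear variety. Then the following are equivalent: (1) $\det_{n,k}(X)=0$ for all $X\in\mathcal K$ and $\operatorname{codim}(\mathcal K)=k$; (2) $k$ is odd and $\mathcal K$ is the vector space of all $X\in M_{n\times k}(\mathbb F)$ whose alternating row sum vanishes, i.e. $\sum_{i=1}^n (-1)^i X[i|) = 0$, where $X[i|)$ denotes the $i$-th row of $X$.
   Context: A linear variety in a finite-dimensional space $W$ is a nonempty set of the form $\mathcal K=\mathbf s+V=\{\mathbf s+\mathbf v:\mathbf v\in V\}$ with $V\subseteq W$ a linear subspace (uniquely determined by $\mathcal K$); $\dim\mathcal K=\dim V$ and $\operatorname{codim}\mathcal K=\dim W-\dim V$. Here $W=M_{n\times k}(\mathbb F)$, of dimension $nk$. Cullis' determinant: for $n\ge k$ and $X\in M_{n\times k}(\mathbb F)$, $\det_{n,k}(X)=\sum_{c}\operatorname{sgn}(c)\det\big(X[c|)\big)$, where $c$ ranges over the $k$-element subsets of $[n]=\{1,\dots,n\}$, $X[c|)$ is the $k\times k$ submatrix of $X$ formed by the rows with indices in $c$ (in increasing order), and, writing $c=\{c(1)<\dots<c(k)\}$, $\operatorname{sgn}(c)=(-1)^{\sum_{\alpha=1}^k (c(\alpha)-\alpha)}$. For $n=k$ it is the ordinary determinant. *)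

theory Defs
  imports Complex_Main "HOL-Library.Function_Algebras" "HOL-Combinatorics.Permutations"
begin

text \<open>An n x k matrix over a field is modelled as a function nat => nat => 'a,
  with rows indexed by 1..n and columns by 1..k, and all entries outside
  this range equal to zero.  Addition and scaling are pointwise.\<close>

definition mat_space :: "nat \<Rightarrow> nat \<Rightarrow> (nat \<Rightarrow> nat \<Rightarrow> 'a::zero) set" where
  "mat_space n k = {X. \<forall>i j. (i \<notin> {1..n} \<or> j \<notin> {1..k}) \<longrightarrow> X i j = 0}"

definition mscale :: "'a::field \<Rightarrow> (nat \<Rightarrow> nat \<Rightarrow> 'a) \<Rightarrow> (nat \<Rightarrow> nat \<Rightarrow> 'a)" where
  "mscale c X = (\<lambda>i j. c * X i j)"

lemma vector_space_mscale: "vector_space (mscale :: 'a::field \<Rightarrow> _)"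
  unfolding vector_space_def mscale_def by (auto simp: algebra_simps fun_eq_iff)

definition det_k :: "nat \<Rightarrow> (nat \<Rightarrow> nat \<Rightarrow> 'a::comm_ring_1) \<Rightarrow> 'a" where
  "det_k k M = (\<Sum>p | p permutes {1..k}. of_int (sign p) * (\<Prod>i\<in>{1..k}. M i (p i)))"

definition elem_of :: "nat set \<Rightarrow> nat \<Rightarrow> nat" where
  "elem_of c \<alpha> = sorted_list_of_set c ! (\<alpha> - 1)"

definition rows_sub :: "(nat \<Rightarrow> nat \<Rightarrow> 'a) \<Rightarrow> nat set \<Rightarrow> (nat \<Rightarrow> nat \<Rightarrow> 'a)" where
  "rows_sub X c = (\<lambda>\<alpha> j. X (elem_of c \<alpha>) j)"

definition sgn_sub :: "nat \<Rightarrow> nat set \<Rightarrow> int" where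
  "sgn_sub k c = (-1) ^ (\<Sum>\<alpha>=1..k. elem_of c \<alpha> - \<alpha>)"

definition cullis_det :: "nat \<Rightarrow> nat \<Rightarrow> (nat \<Rightarrow> nat \<Rightarrow> 'a::comm_ring_1) \<Rightarrow> 'a" where
  "cullis_det n k X = (\<Sum>c | c \<subseteq> {1..n} \<and> card c = k. of_int (sgn_sub k c) * det_k k (rows_sub X c))"

definition linear_variety :: "nat \<Rightarrow> nat \<Rightarrow> (nat \<Rightarrow> nat \<Rightarrow> 'a::field) set \<Rightarrow> bool" where
  "linear_variety n k K \<longleftrightarrow> (\<exists>s V. s \<in> mat_space n k \<and> V \<subseteq> mat_space n k \<and>
      module.subspace mscale V \<and> K = (\<lambda>v. s + v) ` V)"

definition direction :: "(nat \<Rightarrow> nat \<Rightarrow> 'a::ab_group_add) set \<Rightarrow> (nat \<Rightarrow> nat \<Rightarrow> 'a) set" where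
  "direction K = {X - Y | X Y. X \<in> K \<and> Y \<in> K}"

definition variety_codim :: "nat \<Rightarrow> nat \<Rightarrow> (nat \<Rightarrow> nat \<Rightarrow> 'a::field) set \<Rightarrow> nat" where
  "variety_codim n k K = n * k - vector_space.dim mscale (direction K)"

end

theory Submission
  imports Defs "Jordan_Normal_Form.Determinant"
begin

text \<open>
  After multiplying row \<open>i\<close> by \<open>(-1)^i\<close>, Cullis' determinant becomes, up to sign, the unsigned sum
  of all maximal minors, i.e. the top degree part of \<open>\<Prod>\<^sub>i (1 + r\<^sub>i)\<close> in the exterior algebra, where
  \<open>r\<^sub>1, \<dots>, r\<^sub>n\<close> are the rows. With \<open>S = \<Sum>\<^sub>i r\<^sub>i\<close> this product is \<open>(1 + S) E\<close> for an even \<open>E\<close>, so for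
  odd \<open>k\<close> the form vanishes whenever \<open>S = 0\<close>.

  For the converse, let the form vanish on a coset \<open>s + V\<close> of codimension at most \<open>k\<close> and argue by
  induction on \<open>k\<close>. Suppose that the last column can be any unit vector \<open>e\<^sub>i\<close>. Deleting it together
  with row \<open>i\<close>, which absorbs one of the \<open>k\<close> dimensions, leads to the statement for \<open>k - 1\<close>, and
  comparing the results for different \<open>i\<close> shows that the matrices of \<open>V\<close> with last column \<open>0\<close> have
  alternating rows; these are too few. So a nontrivial functional of the last column vanishes on
  \<open>V\<close>. The same holds for every nontrivial combination of columns, whence \<open>V\<close> consists of all \<open>X\<close>
  with \<open>a\<^sup>T X = 0\<close> for a fixed \<open>a \<noteq> 0\<close>. As \<open>(1 + y) (1 - y) = 1\<close>, opposite adjacent rows can be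
  deleted, which forces \<open>a\<close> to be constant.
\<close>

section \<open>Codimension and linear functionals\<close>

text \<open>The ambient type may be infinite-dimensional, so quotients of its subspaces have no \<open>dim\<close>;
  instead the codimension of \<open>V\<close> in \<open>W\<close> is bounded by the number of vectors of \<open>W\<close> that are
  independent modulo \<open>V\<close>. It is not required that \<open>V \<subseteq> W\<close>.\<close>

definition codim_le ::
  "('a::zero \<Rightarrow> 'b::comm_monoid_add \<Rightarrow> 'b) \<Rightarrow> 'b set \<Rightarrow> 'b set \<Rightarrow> nat \<Rightarrow> bool" where
  "codim_le scale W V d \<longleftrightarrow> (\<forall>S. finite S \<and> S \<subseteq> W \<and> d < card S \<longrightarrow>
    (\<exists>c. (\<exists>x\<in>S. c x \<noteq> 0) \<and> (\<Sum>x\<in>S. scale (c x) x) \<in> V))"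

lemma codim_leI:
  assumes "\<And>S. finite S \<Longrightarrow> S \<subseteq> W \<Longrightarrow> d < card S \<Longrightarrow>
    \<exists>c. (\<exists>x\<in>S. c x \<noteq> 0) \<and> (\<Sum>x\<in>S. scale (c x) x) \<in> V"
  shows "codim_le scale W V d"
  using assms by (auto simp: codim_le_def)

lemma codim_leE:
  assumes "codim_le scale W V d" "finite S" "S \<subseteq> W" "d < card S"
  obtains c where "\<exists>x\<in>S. c x \<noteq> 0" "(\<Sum>x\<in>S. scale (c x) x) \<in> V"
  using assms unfolding codim_le_def by blast

lemma codim_le_subset: "codim_le scale W V d \<Longrightarrow> W' \<subseteq> W \<Longrightarrow> codim_le scale W' V d"
  unfolding codim_le_def by blast

lemma codim_le_mono: "codim_le scale W V d \<Longrightarrow> d \<le> e \<Longrightarrow> codim_le scale W V e"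
  unfolding codim_le_def by fastforce

context vector_space
begin

lemma codim_le_Int:
  assumes "codim_le scale W V d" "subspace W"
  shows "codim_le scale W (V \<inter> W) d"
proof (rule codim_leI)
  fix S assume S: "finite S" "S \<subseteq> W" "d < card S"
  then obtain c where "\<exists>x\<in>S. c x \<noteq> 0" "(\<Sum>x\<in>S. c x *s x) \<in> V"
    using codim_leE[OF assms(1)] by blast
  moreover have "(\<Sum>x\<in>S. c x *s x) \<in> W"
    using S(2) assms(2) by (intro subspace_sum subspace_scale) auto
  ultimately show "\<exists>c. (\<exists>x\<in>S. c x \<noteq> 0) \<and> (\<Sum>x\<in>S. c x *s x) \<in> V \<inter> W" by blast
qed

lemma subspace_scaleD:
  assumes "subspace V" "a \<noteq> 0" "a *s x \<in> V"
  shows "x \<in> V"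
  using subspace_scale[OF assms(1,3), of "inverse a"] assms(2) by simp

lemma sum_unit_coefficient:
  assumes "finite S" "x \<in> S"
  shows "(\<Sum>y\<in>S. (if y = x then 1 else 0) *s y) = x"
proof -
  have "(\<Sum>y\<in>S. (if y = x then 1 else 0) *s y) = (\<Sum>y\<in>S. if y = x then x else 0)"
    by (rule sum.cong) auto
  then show ?thesis using assms by simp
qed

lemma codim_le_span_insert:
  assumes codim: "codim_le scale W V (Suc d)" and V: "subspace V" and x: "x \<in> W" "x \<notin> V"
  shows "codim_le scale W (span (insert x V)) d"
proof (rule codim_leI)
  fix S assume S: "finite S" "S \<subseteq> W" "d < card S"
  show "\<exists>c. (\<exists>y\<in>S. c y \<noteq> 0) \<and> (\<Sum>y\<in>S. c y *s y) \<in> span (insert x V)"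
  proof (cases "x \<in> S")
    case True
    then have "(\<Sum>y\<in>S. (if y = x then 1 else 0) *s y) = x"
      using S(1) by (intro sum_unit_coefficient)
    then show ?thesis
      using True by (intro exI[of _ "\<lambda>y. if y = x then 1 else 0"]) (auto intro: span_base)
  next
    case False
    with S have "Suc d < card (insert x S)" by simp
    then obtain c where c: "\<exists>y\<in>insert x S. c y \<noteq> 0" "(\<Sum>y\<in>insert x S. c y *s y) \<in> V"
      using codim_leE[OF codim] S x(1) by (metis finite_insert insert_subset)
    have sum: "(\<Sum>y\<in>insert x S. c y *s y) = c x *s x + (\<Sum>y\<in>S. c y *s y)"
      using False S(1) by simp
    have "\<exists>y\<in>S. c y \<noteq> 0"
    proof (rule ccontr)
      assume none: "\<not> ?thesis"
      then have "c x *s x \<in> V" using c(2) sum by simp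
      then show False using none c(1) x(2) subspace_scaleD[OF V] by blast
    qed
    moreover have "(\<Sum>y\<in>S. c y *s y) = (\<Sum>y\<in>insert x S. c y *s y) - c x *s x"
      by (simp add: sum)
    then have "(\<Sum>y\<in>S. c y *s y) \<in> span (insert x V)"
      using c(2) by (auto intro: span_diff span_scale span_base)
    ultimately show ?thesis by blast
  qed
qed

lemma independent_modulo_span:
  assumes B: "finite B" "independent B" and "finite S"
    and modulo: "\<And>c. (\<Sum>x\<in>S. c x *s x) \<in> span B \<Longrightarrow> \<forall>x\<in>S. c x = 0"
  shows "B \<inter> S = {}" and "independent (B \<union> S)"
proof -
  show disjoint: "B \<inter> S = {}"
  proof (rule ccontr)
    assume "\<not> ?thesis"
    then obtain b where b: "b \<in> B" "b \<in> S" by blast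
    have "(\<Sum>x\<in>S. (if x = b then 1 else 0) *s x) \<in> span B"
      using b by (simp only: sum_unit_coefficient[OF assms(3)] span_base)
    from bspec[OF modulo[OF this] b(2)] show False by simp
  qed
  show "independent (B \<union> S)"
  proof (rule independent_if_scalars_zero)
    fix c x assume "(\<Sum>x\<in>B \<union> S. c x *s x) = 0" and x: "x \<in> B \<union> S"
    then have sum_0: "(\<Sum>x\<in>B. c x *s x) + (\<Sum>x\<in>S. c x *s x) = 0"
      using assms(1,3) disjoint by (simp add: sum.union_disjoint)
    then have "(\<Sum>x\<in>S. c x *s x) = - (\<Sum>x\<in>B. c x *s x)"
      by (simp add: add_eq_0_iff)
    also have "\<dots> \<in> span B"
      by (intro span_neg span_sum span_scale span_base)
    finally have c_S: "\<forall>x\<in>S. c x = 0" by (rule modulo)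
    then have "(\<Sum>x\<in>B. c x *s x) = 0" using sum_0 by simp
    then have "c x = 0" if "x \<in> B" for x
      using independentD[OF B(2,1) _ _ that] by blast
    with c_S x show "c x = 0" by blast
  qed (use assms in simp)
qed

lemma codim_le_card_minus_dim:
  assumes E: "finite E" and V: "subspace V" "V \<subseteq> span E"
  shows "codim_le scale (span E) V (card E - dim V)"
proof (rule codim_leI, rule ccontr)
  fix S assume S: "finite S" "S \<subseteq> span E" "card E - dim V < card S"
    and none: "\<not> (\<exists>c. (\<exists>x\<in>S. c x \<noteq> 0) \<and> (\<Sum>x\<in>S. c x *s x) \<in> V)"
  obtain B where B: "B \<subseteq> V" "independent B" "V \<subseteq> span B" "card B = dim V"
    by (rule basis_exists)
  then have "span B = V" by (intro span_subspace V)
  then have modulo: "\<forall>x\<in>S. c x = 0" if "(\<Sum>x\<in>S. c x *s x) \<in> span B" for c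
    using none that by blast
  have "finite B"
    using independent_span_bound[OF E B(2)] B(1) V(2) by blast
  note BS = independent_modulo_span[OF \<open>finite B\<close> B(2) S(1) modulo]
  have "card B + card S = card (B \<union> S)"
    using BS(1) S(1) \<open>finite B\<close> by (simp add: card_Un_disjoint)
  also have "\<dots> \<le> card E"
    using independent_span_bound[OF E BS(2)] B(1) V(2) S(2) by blast
  finally show False using S(3) B(4) by simp
qed

lemma mem_subspace_if_functionals_eq_0:
  assumes V: "subspace V" "codim_le scale W V (card J)" and J: "finite J"
    and linear: "\<And>j. j \<in> J \<Longrightarrow> Vector_Spaces.linear scale (*) (\<phi> j)"
    and \<phi>_V: "\<And>j v. j \<in> J \<Longrightarrow> v \<in> V \<Longrightarrow> \<phi> j v = 0"
    and u: "\<And>j. j \<in> J \<Longrightarrow> u j \<in> W" "\<And>j. j \<in> J \<Longrightarrow> \<phi> j (u j) \<noteq> 0"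
      "\<And>i j. i \<in> J \<Longrightarrow> j \<in> J \<Longrightarrow> i \<noteq> j \<Longrightarrow> \<phi> i (u j) = 0"
    and x: "x \<in> W" "\<And>j. j \<in> J \<Longrightarrow> \<phi> j x = 0"
  shows "x \<in> V"
proof -
  have "inj_on u J" using u(2,3) by (metis inj_onI)
  have "x \<notin> u ` J" using x(2) u(2) by auto
  then have "card J < card (insert x (u ` J))"
    using J card_image[OF \<open>inj_on u J\<close>] by simp
  then obtain c where c: "\<exists>y\<in>insert x (u ` J). c y \<noteq> 0"
    and "(\<Sum>y\<in>insert x (u ` J). c y *s y) \<in> V"
    using codim_leE[OF V(2), of "insert x (u ` J)"] J u(1) x(1) by auto
  moreover have "(\<Sum>y\<in>insert x (u ` J). c y *s y) = c x *s x + (\<Sum>j\<in>J. c (u j) *s u j)"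
    using J \<open>x \<notin> u ` J\<close> by (simp add: sum.reindex[OF \<open>inj_on u J\<close>])
  ultimately have v: "c x *s x + (\<Sum>j\<in>J. c (u j) *s u j) \<in> V" by simp
  have c_u: "c (u i) = 0" if i: "i \<in> J" for i
  proof -
    interpret \<phi>: Vector_Spaces.linear scale "(*)" "\<phi> i" by (rule linear[OF i])
    have "0 = c x * \<phi> i x + (\<Sum>j\<in>J. c (u j) * \<phi> i (u j))"
      using \<phi>_V[OF i v] by (simp add: \<phi>.add \<phi>.scale \<phi>.sum)
    also have "(\<Sum>j\<in>J. c (u j) * \<phi> i (u j)) = (\<Sum>j\<in>J. if j = i then c (u i) * \<phi> i (u i) else 0)"
      by (rule sum.cong) (use u(3)[OF i] in auto)
    finally show ?thesis using i J u(2)[OF i] x(2)[OF i] by simp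
  qed
  then have "c x \<noteq> 0" using c by auto
  moreover have "c x *s x \<in> V" using v c_u by simp
  ultimately show ?thesis by (rule subspace_scaleD[OF V(1)])
qed

lemma subspace_separation:
  assumes W: "subspace W" and x: "x \<notin> W"
  obtains \<phi> where "Vector_Spaces.linear scale (*) \<phi>" "\<And>v. v \<in> W \<Longrightarrow> \<phi> v = 0" "\<phi> x = 1"
proof -
  interpret functional: vector_space_pair scale "(*)"
    by unfold_locales (auto simp: algebra_simps)
  obtain B where B: "B \<subseteq> W" "independent B" "W \<subseteq> span B"
    by (rule maximal_independent_subset)
  then have span_B: "span B = W" by (intro span_subspace W)
  then have "independent (insert x B)"
    using B x by (simp add: independent_insertI)
  then obtain \<phi> where linear: "Vector_Spaces.linear scale (*) \<phi>"
    and \<phi>: "\<forall>v\<in>insert x B. \<phi> v = (if v = x then 1 else 0)"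
    using functional.linear_independent_extend[where f = "\<lambda>v. if v = x then 1 else 0"] by blast
  interpret \<phi>: Vector_Spaces.linear scale "(*)" \<phi> by (rule linear)
  have "\<phi> v = 0" if "v \<in> B" for v
    using that \<phi> x B(1) by auto
  then have "\<phi> v = 0" if "v \<in> W" for v
    using \<phi>.eq_0_on_span that span_B by blast
  with linear \<phi> that show thesis by simp
qed

end

context vector_space_pair
begin

lemma codim_le_image:
  assumes linear: "Vector_Spaces.linear s1 s2 f" and W': "W' \<subseteq> f ` W" and codim: "codim_le s1 W V d"
  shows "codim_le s2 W' (f ` V) d"
proof (rule codim_leI)
  interpret f: Vector_Spaces.linear s1 s2 f by (rule linear)
  fix S assume S: "finite S" "S \<subseteq> W'" "d < card S"
  then obtain T where T: "T \<subseteq> W" "inj_on f T" "S = f ` T"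
    using W' by (meson order_trans subset_image_inj)
  then have "finite T" "card T = card S"
    using S(1) by (auto simp: finite_image_iff card_image)
  then obtain c where c: "\<exists>x\<in>T. c x \<noteq> 0" "(\<Sum>x\<in>T. s1 (c x) x) \<in> V"
    using codim_leE[OF codim _ T(1)] S(3) by metis
  have "(\<Sum>y\<in>S. s2 (c (inv_into T f y)) y) = f (\<Sum>x\<in>T. s1 (c x) x)"
    using T(2) by (simp add: T(3) sum.reindex f.sum f.scale)
  then show "\<exists>c. (\<exists>y\<in>S. c y \<noteq> 0) \<and> (\<Sum>y\<in>S. s2 (c y) y) \<in> f ` V"
    using c T(2) by (intro exI[of _ "\<lambda>y. c (inv_into T f y)"]) (auto simp: T(3))
qed

lemma dim_image_eq_if_inj_on_span:
  assumes linear: "Vector_Spaces.linear s1 s2 f"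
    and inj: "inj_on f (vs1.span B)" and B: "vs1.independent B"
  shows "vs2.dim (f ` vs1.span B) = card B"
proof -
  interpret f: Vector_Spaces.linear s1 s2 f by (rule linear)
  have "vs2.dim (f ` vs1.span B) = vs2.dim (f ` B)"
    by (simp add: f.span_image[symmetric])
  also have "\<dots> = card (f ` B)"
    using f.independent_injective_image[OF B inj] by (rule vs2.dim_eq_card_independent)
  also have "\<dots> = card B"
    using inj by (intro card_image inj_on_subset[OF inj] vs1.span_superset)
  finally show ?thesis .
qed

end

lemma sum_fun_apply: "(\<Sum>p\<in>A. F p) i = (\<Sum>p\<in>A. F p i)"
  by (induction A rule: infinite_finite_induct) auto

definition fun_scale :: "'a::times \<Rightarrow> ('i \<Rightarrow> 'a) \<Rightarrow> 'i \<Rightarrow> 'a" where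
  "fun_scale c x = (\<lambda>i. c * x i)"

interpretation vec: vector_space "fun_scale :: 'a::field \<Rightarrow> _"
  by unfold_locales (auto simp: fun_scale_def algebra_simps)

lemma linear_functional_eq_sum:
  fixes \<phi> :: "('i \<Rightarrow> 'a::field) \<Rightarrow> 'a"
  assumes linear: "Vector_Spaces.linear fun_scale (*) \<phi>"
    and A: "finite A" and x: "\<And>i. i \<notin> A \<Longrightarrow> x i = 0"
  shows "\<phi> x = (\<Sum>i\<in>A. \<phi> (\<lambda>j. if j = i then 1 else 0) * x i)"
proof -
  have "x j = (\<Sum>i\<in>A. fun_scale (x i) (\<lambda>j. if j = i then 1 else 0)) j" for j
    using A x[of j] by (simp add: sum_fun_apply fun_scale_def if_distrib cong: if_cong)
  then have x_eq: "x = (\<Sum>i\<in>A. fun_scale (x i) (\<lambda>j. if j = i then 1 else 0))" by blast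
  interpret \<phi>: Vector_Spaces.linear fun_scale "(*)" \<phi> by (rule linear)
  have "\<phi> x = \<phi> (\<Sum>i\<in>A. fun_scale (x i) (\<lambda>j. if j = i then 1 else 0))"
    using x_eq by (rule arg_cong)
  also have "\<dots> = (\<Sum>i\<in>A. \<phi> (\<lambda>j. if j = i then 1 else 0) * x i)"
    by (simp only: \<phi>.sum \<phi>.scale mult.commute)
  finally show ?thesis .
qed

lemma subspace_annihilator:
  fixes U :: "('i \<Rightarrow> 'a::field) set"
  assumes A: "finite A" and U: "vec.subspace U" "\<forall>u\<in>U. \<forall>i. i \<notin> A \<longrightarrow> u i = 0"
    and e: "e \<notin> U" "\<forall>i. i \<notin> A \<longrightarrow> e i = 0"
  obtains a where "\<exists>i\<in>A. a i \<noteq> 0" "\<And>u. u \<in> U \<Longrightarrow> (\<Sum>i\<in>A. a i * u i) = 0"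
proof -
  obtain \<phi> where linear: "Vector_Spaces.linear fun_scale (*) \<phi>"
    and \<phi>: "\<And>u. u \<in> U \<Longrightarrow> \<phi> u = 0" "\<phi> e = 1"
    by (rule vec.subspace_separation[OF U(1) e(1)]) blast
  define a where "a i = \<phi> (\<lambda>j. if j = i then 1 else 0)" for i
  have eval: "\<phi> x = (\<Sum>i\<in>A. a i * x i)" if "\<forall>i. i \<notin> A \<longrightarrow> x i = 0" for x
    unfolding a_def using linear_functional_eq_sum[OF linear A] that by blast
  show thesis
  proof
    have "(\<Sum>i\<in>A. a i * e i) \<noteq> 0" using eval[OF e(2)] \<phi>(2) by simp
    then obtain i where "i \<in> A" "a i * e i \<noteq> 0" by (rule sum.not_neutral_contains_not_neutral)
    then show "\<exists>i\<in>A. a i \<noteq> 0" by auto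
    show "(\<Sum>i\<in>A. a i * u i) = 0" if "u \<in> U" for u
      using eval[OF bspec[OF U(2) that]] \<phi>(1)[OF that] by simp
  qed
qed

lemma proportional_if_annihilator_subset:
  fixes a b :: "'i \<Rightarrow> 'a::field"
  assumes A: "finite A" "\<exists>i\<in>A. a i \<noteq> 0" "\<exists>i\<in>A. b i \<noteq> 0"
    and annihilator: "\<And>x. (\<Sum>i\<in>A. a i * x i) = 0 \<Longrightarrow> (\<Sum>i\<in>A. b i * x i) = 0"
  obtains \<mu> where "\<mu> \<noteq> 0" "\<And>i. i \<in> A \<Longrightarrow> b i = \<mu> * a i"
proof -
  obtain q where q: "q \<in> A" "a q \<noteq> 0" using A(2) by blast
  have proportional: "b i = b q / a q * a i" if i: "i \<in> A" for i
  proof (cases "i = q")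
    case False
    define x where "x = (\<lambda>l. if l = i then a q else if l = q then - a i else 0)"
    have eval: "(\<Sum>l\<in>A. d l * x l) = d i * a q - d q * a i" for d :: "'i \<Rightarrow> 'a"
    proof -
      have "(\<Sum>l\<in>A. d l * x l) =
          (\<Sum>l\<in>A. (if l = i then d i * a q else 0) + (if l = q then - (d q * a i) else 0))"
        by (rule sum.cong) (use False in \<open>auto simp: x_def\<close>)
      then show ?thesis using i q(1) A(1) by (simp add: sum.distrib)
    qed
    have "b i * a q = b q * a i"
      using annihilator[of x] by (simp add: eval mult.commute)
    then show ?thesis using q(2) by (simp add: field_simps)
  qed (use q in simp)
  moreover have "b q / a q \<noteq> 0" using proportional A(3) by force
  ultimately show thesis using that by blast
qed

section \<open>Determinants\<close>

lemma bij_betw_map_permutation: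
  assumes "bij_betw f A B"
  shows "bij_betw (map_permutation A f) {p. p permutes A} {p. p permutes B}"
proof -
  have "map_permutation A f = (\<lambda>p x. if x \<in> B then f (p (inv_into A f x)) else x)"
    using bij_betw_imp_surj_on[OF assms]
    by (simp add: map_permutation_def restrict_id_def fun_eq_iff)
  then show ?thesis by (simp only: bij_betw_permutations[OF assms])
qed

lemma det_k_eq_det: "det_k k M = det (mat k k (\<lambda>(i, j). M (Suc i) (Suc j)))"
proof -
  let ?A = "mat k k (\<lambda>(i, j). M (Suc i) (Suc j))"
  let ?shift = "map_permutation {0..<k} Suc"
  have bij: "bij_betw Suc {0..<k} {1..k}"
    by (simp add: bij_betw_def atLeastLessThanSuc_atLeastAtMost)
  have term_eq: "(\<Prod>i\<in>{1..k}. M i (?shift p i)) = (\<Prod>i = 0..<k. ?A $$ (i, p i))"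
    if p: "p permutes {0..<k}" for p
  proof -
    have "(\<Prod>i\<in>{1..k}. M i (?shift p i)) = (\<Prod>i = 0..<k. M (Suc i) (?shift p (Suc i)))"
      by (rule prod.reindex_bij_betw[OF bij, symmetric])
    also have "\<dots> = (\<Prod>i = 0..<k. ?A $$ (i, p i))"
    proof (rule prod.cong[OF refl])
      fix i assume i: "i \<in> {0..<k}"
      then have "p i < k" using permutes_in_image[OF p, of i] by simp
      moreover have "?shift p (Suc i) = Suc (p i)"
        using i by (intro map_permutation_apply) auto
      ultimately show "M (Suc i) (?shift p (Suc i)) = ?A $$ (i, p i)" using i by simp
    qed
    finally show ?thesis .
  qed
  have "det_k k M =
      (\<Sum>p | p permutes {0..<k}. of_int (sign (?shift p)) * (\<Prod>i\<in>{1..k}. M i (?shift p i)))"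
    unfolding det_k_def
    by (rule sum.reindex_bij_betw[OF bij_betw_map_permutation[OF bij], symmetric])
  also have "\<dots> = (\<Sum>p | p permutes {0..<k}. of_int (sign p) * (\<Prod>i = 0..<k. ?A $$ (i, p i)))"
    by (rule sum.cong)
      (simp_all only: mem_Collect_eq term_eq sign_map_permutation inj_Suc finite_atLeastLessThan)
  also have "\<dots> = det ?A"
    by (rule det_def'[symmetric]) simp
  finally show ?thesis .
qed

lemma det_k_cong:
  assumes "\<And>i j. i \<in> {1..k} \<Longrightarrow> j \<in> {1..k} \<Longrightarrow> M i j = N i j"
  shows "det_k k M = det_k k N"
proof -
  have "mat k k (\<lambda>(i, j). M (Suc i) (Suc j)) = mat k k (\<lambda>(i, j). N (Suc i) (Suc j))"
    using assms by (intro cong_mat) auto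
  then show ?thesis by (simp add: det_k_eq_det)
qed

lemma det_k_scale_rows: "det_k k (\<lambda>i j. u i * M i j) = (\<Prod>i\<in>{1..k}. u i) * det_k k M"
  unfolding det_k_def by (simp add: prod.distrib sum_distrib_left mult_ac)

lemma det_k_row_add:
  assumes m: "m \<in> {1..k}" and A: "\<And>i. i \<in> {1..k} - {m} \<Longrightarrow> A i = C i"
    and B: "\<And>i. i \<in> {1..k} - {m} \<Longrightarrow> B i = C i" and C: "C m = A m + B m"
  shows "det_k k C = det_k k A + det_k k B"
proof -
  have split: "(\<Prod>i\<in>{1..k}. M i (p i)) = M m (p m) * (\<Prod>i\<in>{1..k} - {m}. C i (p i))"
    if "\<And>i. i \<in> {1..k} - {m} \<Longrightarrow> M i = C i" for M p
    using m that by (subst prod.remove[of _ m]) (auto intro!: prod.cong)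
  show ?thesis
    unfolding det_k_def sum.distrib[symmetric]
    by (intro sum.cong refl, subst (1 2 3) split) (use A B C in \<open>auto simp: ring_distribs\<close>)
qed

lemma det_k_row_scale:
  assumes "m \<in> {1..k}" and "\<And>i. i \<in> {1..k} - {m} \<Longrightarrow> A i = C i" and "\<And>j. C m j = c * A m j"
  shows "det_k k C = c * det_k k A"
proof -
  have "det_k k C = det_k k (\<lambda>i j. (if i = m then c else 1) * A i j)"
    by (rule det_k_cong) (use assms in auto)
  then show ?thesis using assms(1) by (simp add: det_k_scale_rows)
qed

lemma det_k_identical_rows:
  assumes "i \<in> {1..k}" "j \<in> {1..k}" "i \<noteq> j" "M i = M j"
  shows "det_k k M = 0"
  unfolding det_k_eq_det
  by (rule det_identical_rows[of _ k "i - 1" "j - 1"]) (use assms in \<open>auto simp: fun_eq_iff\<close>)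

lemma det_k_mult: "det_k k (\<lambda>i j. \<Sum>l\<in>{1..k}. M i l * g l j) = det_k k M * det_k k g"
proof -
  let ?mat = "\<lambda>M :: nat \<Rightarrow> nat \<Rightarrow> 'a. mat k k (\<lambda>(i, j). M (Suc i) (Suc j))"
  have "?mat (\<lambda>i j. \<Sum>l\<in>{1..k}. M i l * g l j) = ?mat M * ?mat g"
    unfolding image_Suc_lessThan[symmetric]
    by (rule eq_matI) (auto simp: scalar_prod_def sum.reindex atLeast0LessThan)
  then show ?thesis
    by (simp add: det_k_eq_det det_mult[of _ k])
qed

lemma det_k_last_column_first_row:
  assumes "\<And>i. i \<in> {2..Suc k} \<Longrightarrow> M i (Suc k) = 0"
  shows "det_k (Suc k) M = (-1) ^ k * M 1 (Suc k) * det_k k (\<lambda>i. M (Suc i))"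
proof -
  let ?A = "mat (Suc k) (Suc k) (\<lambda>(i, j). M (Suc i) (Suc j))"
  have "det ?A = (\<Sum>i<Suc k. ?A $$ (i, k) * cofactor ?A i k)"
    by (rule laplace_expansion_column) simp_all
  also have "\<dots> = (\<Sum>i<Suc k. if i = 0 then M 1 (Suc k) * cofactor ?A 0 k else 0)"
    by (rule sum.cong) (use assms in auto)
  also have "\<dots> = M 1 (Suc k) * cofactor ?A 0 k"
    by (simp add: sum.delta)
  also have "mat_delete ?A 0 k = mat k k (\<lambda>(i, j). M (Suc (Suc i)) (Suc j))"
    by (intro eq_matI) (auto simp: mat_delete_def)
  then have "cofactor ?A 0 k = (-1) ^ k * det_k k (\<lambda>i. M (Suc i))"
    by (simp add: cofactor_def det_k_eq_det)
  finally show ?thesis by (simp add: det_k_eq_det mult_ac)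
qed

lemma det_k_identity_replace_row:
  assumes m: "m \<in> {1..k}"
  shows "det_k k (\<lambda>i j. if i = m then b j else if i = j then 1 else 0) = b m"
proof -
  let ?A = "mat k k (\<lambda>(i, j). if Suc i = m then b (Suc j) else if i = j then 1 else 0)"
  let ?b = "vec k (\<lambda>j. b (Suc j))"
  have "?A\<^sup>T = replace_col (1\<^sub>m k) (1\<^sub>m k *\<^sub>v ?b) (m - 1)"
    using m by (intro eq_matI) (auto simp: replace_col_def)
  also have "det \<dots> = ?b $ (m - 1) * det (1\<^sub>m k)"
    using m by (intro cramer_lemma_mat) auto
  also have "m - 1 < k" using m by auto
  then have "?b $ (m - 1) * det (1\<^sub>m k) = b m" using m by simp
  finally have "det (?A\<^sup>T) = b m" .
  then have "det ?A = b m" by (simp add: det_transpose[of ?A k])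
  then show ?thesis by (simp add: det_k_eq_det cong: if_cong)
qed

lemma det_k_identity: "det_k k (\<lambda>i j. if i = j then 1 else 0) = 1"
proof -
  have "mat k k (\<lambda>(i, j). if Suc i = Suc j then 1 else 0) = (1\<^sub>m k :: 'a mat)"
    by (intro eq_matI) auto
  then show ?thesis by (simp add: det_k_eq_det)
qed

definition det_rows :: "nat \<Rightarrow> (nat \<Rightarrow> 'a::comm_ring_1) list \<Rightarrow> 'a" where
  "det_rows k ws = det_k k (\<lambda>i. ws ! (i - 1))"

lemma det_rows_add:
  assumes "Suc (length u + length v) = k"
  shows "det_rows k (u @ (x + y) # v) = det_rows k (u @ x # v) + det_rows k (u @ y # v)"
  unfolding det_rows_def
  by (rule det_k_row_add[where m = "Suc (length u)"])
    (use assms in \<open>auto simp: nth_append nth_Cons' fun_eq_iff\<close>)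

lemma det_rows_scale:
  assumes "Suc (length u + length v) = k"
  shows "det_rows k (u @ (\<lambda>j. c * x j) # v) = c * det_rows k (u @ x # v)"
  unfolding det_rows_def
  by (rule det_k_row_scale[where m = "Suc (length u)"])
    (use assms in \<open>auto simp: nth_append nth_Cons' fun_eq_iff\<close>)

lemma det_rows_alternating:
  assumes "length u + length v + 2 = k"
  shows "det_rows k (u @ x # x # v) = 0"
  unfolding det_rows_def
  by (rule det_k_identical_rows[where i = "Suc (length u)" and j = "Suc (Suc (length u))"])
    (use assms in \<open>auto simp: nth_append nth_Cons' fun_eq_iff\<close>)

lemma det_rows_cong:
  assumes "length v = k" and "list_all2 (\<lambda>r s. \<forall>j\<in>{1..k}. r j = s j) v w"
  shows "det_rows k v = det_rows k w"
  unfolding det_rows_def by (rule det_k_cong) (use assms in \<open>auto simp: list_all2_conv_all_nth\<close>)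

lemma det_rows_Cons_last_column:
  assumes "length v = k" and "\<And>s. s \<in> set v \<Longrightarrow> s (Suc k) = 0"
  shows "det_rows (Suc k) (r # v) = (-1) ^ k * r (Suc k) * det_rows k v"
proof -
  have "det_rows (Suc k) (r # v) = (-1) ^ k * r (Suc k) * det_k k (\<lambda>i. (r # v) ! i)"
    unfolding det_rows_def
    by (rule det_k_last_column_first_row[THEN trans]) (use assms in \<open>auto simp: nth_Cons'\<close>)[2]
  also have "det_k k (\<lambda>i. (r # v) ! i) = det_rows k v"
    unfolding det_rows_def by (rule det_k_cong) (auto simp: nth_Cons')
  finally show ?thesis .
qed

lemma det_rows_mult:
  assumes "length w = k"
  shows "det_rows k (map (\<lambda>r j. \<Sum>l\<in>{1..k}. r l * g l j) w) = det_rows k w * det_k k g"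
proof -
  have "det_rows k (map (\<lambda>r j. \<Sum>l\<in>{1..k}. r l * g l j) w) =
    det_k k (\<lambda>i j. \<Sum>l\<in>{1..k}. (w ! (i - 1)) l * g l j)"
    unfolding det_rows_def by (rule det_k_cong) (use assms in auto)
  then show ?thesis by (simp only: det_k_mult det_rows_def)
qed

section \<open>Sums of maximal minors\<close>

text \<open>In the exterior algebra, \<open>minor_sum k w rs\<close> is the component of degree \<open>k\<close> of
  \<open>w\<^sub>1 \<and> \<dots> \<and> w\<^sub>l \<and> \<Prod>\<^sub>i (1 + r\<^sub>i)\<close>.\<close>

fun minor_sum :: "nat \<Rightarrow> (nat \<Rightarrow> 'a::comm_ring_1) list \<Rightarrow> (nat \<Rightarrow> 'a) list \<Rightarrow> 'a" where
  "minor_sum k w [] = (if length w = k then det_rows k w else 0)"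
| "minor_sum k w (r # rs) = minor_sum k w rs + minor_sum k (w @ [r]) rs"

lemma minor_sum_add:
  "minor_sum k (u @ (x + y) # v) rs = minor_sum k (u @ x # v) rs + minor_sum k (u @ y # v) rs"
  by (induction rs arbitrary: v) (simp_all add: det_rows_add)

lemma minor_sum_scale:
  "minor_sum k (u @ (\<lambda>j. c * x j) # v) rs = c * minor_sum k (u @ x # v) rs"
  by (induction rs arbitrary: v) (simp_all add: det_rows_scale ring_distribs)

lemma minor_sum_alternating: "minor_sum k (u @ x # x # v) rs = 0"
  by (induction rs arbitrary: v) (simp_all add: det_rows_alternating)

lemma minor_sum_zero: "minor_sum k (u @ 0 # v) rs = 0"
  using minor_sum_scale[of k u 0 0 v rs] by (simp add: zero_fun_def)

lemma minor_sum_uminus: "minor_sum k (u @ (\<lambda>j. - x j) # v) rs = - minor_sum k (u @ x # v) rs"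
  using minor_sum_scale[of k u "- 1" x v rs] by simp

lemma minor_sum_swap: "minor_sum k (u @ x # y # v) rs = - minor_sum k (u @ y # x # v) rs"
proof -
  have "0 = minor_sum k (u @ (x + y) # (x + y) # v) rs"
    by (simp add: minor_sum_alternating)
  also have "\<dots> = minor_sum k (u @ x # (x + y) # v) rs + minor_sum k (u @ y # (x + y) # v) rs"
    by (rule minor_sum_add)
  also have "minor_sum k (u @ x # (x + y) # v) rs = minor_sum k (u @ x # y # v) rs"
    using minor_sum_add[of k "u @ [x]" x y v rs] by (simp add: minor_sum_alternating)
  also have "minor_sum k (u @ y # (x + y) # v) rs = minor_sum k (u @ y # x # v) rs"
    using minor_sum_add[of k "u @ [y]" x y v rs] by (simp add: minor_sum_alternating)
  finally show ?thesis by (simp add: eq_neg_iff_add_eq_0)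
qed

lemma minor_sum_eq_0_if_too_short: "length w + length rs < k \<Longrightarrow> minor_sum k w rs = 0"
  by (induction rs arbitrary: w) auto

lemma minor_sum_eq_0_if_too_long: "k < length w \<Longrightarrow> minor_sum k w rs = 0"
  by (induction rs arbitrary: w) auto

lemma minor_sum_eq_det_rows:
  "length w + length rs = k \<Longrightarrow> minor_sum k w rs = det_rows k (w @ rs)"
  by (induction rs arbitrary: w) (auto simp: minor_sum_eq_0_if_too_short)

lemma minor_sum_append_zeros: "minor_sum k w (rs @ replicate m 0) = minor_sum k w rs"
proof (induction rs arbitrary: w)
  case Nil
  show ?case
  proof (induction m)
    case (Suc m)
    then show ?case using minor_sum_zero[of k w "[]"] by (simp del: zero_fun_apply)
  qed simp
qed simp

lemma minor_sum_cong:
  assumes "list_all2 (\<lambda>r s. \<forall>j\<in>{1..k}. r j = s j) v w"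
    and "list_all2 (\<lambda>r s. \<forall>j\<in>{1..k}. r j = s j) ps qs"
  shows "minor_sum k v ps = minor_sum k w qs"
  using assms(2,1)
proof (induction arbitrary: v w rule: list_all2_induct)
  case Nil
  then show ?case using det_rows_cong[of v k w] list_all2_lengthD[OF Nil] by simp
next
  case (Cons p ps q qs)
  have "minor_sum k (v @ [p]) ps = minor_sum k (w @ [q]) qs"
    by (rule Cons.IH) (use Cons in \<open>auto intro!: list_all2_appendI\<close>)
  then show ?case using Cons by simp
qed

lemma minor_sum_cancel_opposite:
  "minor_sum k w (ps @ r # (\<lambda>j. - r j) # qs) = minor_sum k w (ps @ qs)"
proof (induction ps arbitrary: w)
  case Nil
  have "minor_sum k (w @ [r, \<lambda>j. - r j]) qs = 0"
    using minor_sum_uminus[of k "w @ [r]" r "[]" qs] minor_sum_alternating[of k w r "[]" qs] by simp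
  then show ?case by (simp add: minor_sum_uminus)
qed simp

text \<open>The signs come from \<open>(1 + p) \<and> r = r \<and> (1 - p)\<close>.\<close>

lemma minor_sum_extract:
  "minor_sum k w (ps @ r # qs) =
    minor_sum k w (ps @ qs) + minor_sum k (w @ [r]) (map (\<lambda>p j. - p j) ps @ qs)"
proof (induction ps arbitrary: w)
  case (Cons p ps)
  have "minor_sum k (w @ [p, r]) rs = minor_sum k (w @ [r, \<lambda>j. - p j]) rs" for rs
    using minor_sum_uminus[of k "w @ [r]" p "[]"] minor_sum_swap[of k w p r "[]"] by simp
  then show ?case using Cons[of w] Cons[of "w @ [p]"] by (simp add: add_ac)
qed simp

lemma minor_sum_Cons_last_column:
  assumes "\<And>s. s \<in> set v \<union> set rs \<Longrightarrow> s (Suc k) = 0"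
  shows "minor_sum (Suc k) (r # v) rs = (-1) ^ k * r (Suc k) * minor_sum k v rs"
  using assms
proof (induction rs arbitrary: v)
  case Nil
  then show ?case by (simp add: det_rows_Cons_last_column)
next
  case (Cons s rs)
  then show ?case using Cons.IH[of v] Cons.IH[of "v @ [s]"] by (auto simp: ring_distribs)
qed

lemma minor_sum_last_column_0:
  assumes "\<And>s. s \<in> set rs \<Longrightarrow> s (Suc k) = 0"
  shows "minor_sum (Suc k) [] rs = 0"
  using assms
proof (induction rs)
  case (Cons s rs)
  then have "minor_sum (Suc k) [s] rs = (-1) ^ k * s (Suc k) * minor_sum k [] rs"
    by (intro minor_sum_Cons_last_column) auto
  then show ?case using Cons.IH Cons.prems[of s] Cons.prems by simp
qed simp

lemma minor_sum_last_column:
  assumes "\<And>s. s \<in> set ps \<union> set qs \<Longrightarrow> s (Suc k) = 0"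
  shows "minor_sum (Suc k) [] (ps @ r # qs) =
    (-1) ^ k * r (Suc k) * minor_sum k [] (map (\<lambda>p j. - p j) ps @ qs)"
proof -
  have "minor_sum (Suc k) [] (ps @ qs) = 0"
    using assms by (intro minor_sum_last_column_0) auto
  then have "minor_sum (Suc k) [] (ps @ r # qs) = minor_sum (Suc k) [r] (map (\<lambda>p j. - p j) ps @ qs)"
    using minor_sum_extract[of "Suc k" "[]" ps r qs] by simp
  also have "\<dots> = (-1) ^ k * r (Suc k) * minor_sum k [] (map (\<lambda>p j. - p j) ps @ qs)"
    using assms by (intro minor_sum_Cons_last_column) auto
  finally show ?thesis .
qed

text \<open>In the exterior algebra, \<open>\<Prod>\<^sub>i (1 + r\<^sub>i) = (1 + S) E\<close> with \<open>S = \<Sum>\<^sub>i r\<^sub>i\<close> and \<open>E\<close> even, because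
  \<open>(1 + S) (1 + r) = (1 + S + r) (1 + S r)\<close>; hence wedging with \<open>S\<close> maps the even part of
  the product to its odd part and kills the odd part.\<close>

lemma minor_sum_snoc_sum_list:
  assumes "length w \<le> k"
  shows "minor_sum k (w @ [sum_list rs]) rs = (if odd (k - length w) then minor_sum k w rs else 0)"
  using assms
proof (induction rs arbitrary: w)
  case Nil
  have "minor_sum k (w @ [sum_list []]) [] = 0" unfolding sum_list.Nil by (rule minor_sum_zero)
  moreover have "odd (k - length w) \<Longrightarrow> length w \<noteq> k" by auto
  ultimately show ?case using Nil by (simp del: sum_list.Nil)
next
  case (Cons r rs)
  let ?S = "sum_list rs"
  show ?case
  proof (cases "length w = k")
    case True
    then show ?thesis by (simp add: minor_sum_eq_0_if_too_long)
  next
    case False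
    with Cons.prems have less: "length w < k" by simp
    have "minor_sum k (w @ [sum_list (r # rs)]) (r # rs)
        = minor_sum k (w @ [r + ?S]) rs + minor_sum k (w @ [r + ?S, r]) rs"
      by simp
    also have "minor_sum k (w @ [r + ?S]) rs = minor_sum k (w @ [r]) rs + minor_sum k (w @ [?S]) rs"
      by (rule minor_sum_add)
    also have "minor_sum k (w @ [r + ?S, r]) rs = minor_sum k (w @ [?S, r]) rs"
      using minor_sum_add[of k w r ?S "[r]" rs] by (simp add: minor_sum_alternating)
    also have "\<dots> = - minor_sum k (w @ [r, ?S]) rs"
      by (rule minor_sum_swap)
    also have "minor_sum k (w @ [?S]) rs = (if odd (k - length w) then minor_sum k w rs else 0)"
      using Cons.IH[of w] less by simp
    also have "minor_sum k (w @ [r, ?S]) rs =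
        (if even (k - length w) then minor_sum k (w @ [r]) rs else 0)"
      using Cons.IH[of "w @ [r]"] less by simp
    finally show ?thesis by (simp del: plus_fun_apply)
  qed
qed

lemma minor_sum_odd_eq_0:
  assumes "odd k" and "sum_list rs = 0"
  shows "minor_sum k [] rs = 0"
  using minor_sum_snoc_sum_list[of "[]" k rs] minor_sum_zero[of k "[]" "[]" rs] assms by simp

lemma minor_sum_even_Cons_uminus_sum_list:
  assumes "even k"
  shows "minor_sum k [] ((\<lambda>j. - sum_list rs j) # rs) = minor_sum k [] rs"
  using minor_sum_snoc_sum_list[of "[]" k rs] minor_sum_uminus[of k "[]" "sum_list rs" "[]" rs]
    assms
  by simp

lemma minor_sum_mult:
  "minor_sum k (map (\<lambda>r j. \<Sum>l\<in>{1..k}. r l * g l j) w) (map (\<lambda>r j. \<Sum>l\<in>{1..k}. r l * g l j) rs)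
    = minor_sum k w rs * det_k k g"
proof (induction rs arbitrary: w)
  case (Cons r rs)
  show ?case using Cons[of w] Cons[of "w @ [r]"] by (simp add: ring_distribs)
qed (simp add: det_rows_mult[unfolded One_nat_def])

lemma sum_Pow_insert:
  assumes "finite A" "x \<notin> A"
  shows "sum f (Pow (insert x A)) = sum f (Pow A) + (\<Sum>c\<in>Pow A. f (insert x c))"
proof -
  have "inj_on (insert x) (Pow A)"
    using assms(2) by (intro inj_onI) (metis PowD insert_ident subsetD)
  moreover have "Pow A \<inter> insert x ` Pow A = {}" using assms(2) by auto
  ultimately show ?thesis
    using assms(1) by (simp add: Pow_insert sum.union_disjoint sum.reindex)
qed

lemma minor_sum_map_sorted:
  assumes "sorted_wrt (<) xs"
  shows "minor_sum k w (map X xs) = (\<Sum>c\<in>Pow (set xs).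
    if length w + card c = k then det_rows k (w @ map X (sorted_list_of_set c)) else 0)"
  using assms
proof (induction xs arbitrary: w)
  case (Cons x xs)
  let ?minor = "\<lambda>w c.
    if length w + card c = k then det_rows k (w @ map X (sorted_list_of_set c)) else 0"
  have x: "x \<notin> set xs" and less: "\<forall>y\<in>set xs. x < y" using Cons.prems by auto
  have insert: "?minor w (insert x c) = ?minor (w @ [X x]) c" if "c \<in> Pow (set xs)" for c
  proof -
    have c: "finite c" "x \<notin> c" using that x finite_subset[of c "set xs"] by auto
    have "sorted_list_of_set (insert x c) = x # sorted_list_of_set c"
      using c less that sorted_list_of_set.idem_if_sorted_distinct[of "x # sorted_list_of_set c"]
      by fastforce
    then show ?thesis using c by simp
  qed
  have "minor_sum k w (map X (x # xs)) =
      sum (?minor w) (Pow (set xs)) + sum (?minor (w @ [X x])) (Pow (set xs))"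
    using Cons by simp
  also have "\<dots> = sum (?minor w) (Pow (set (x # xs)))"
    using insert x by (simp add: sum_Pow_insert)
  finally show ?case .
qed simp

definition maximal_minor_sum :: "nat \<Rightarrow> nat \<Rightarrow> (nat \<Rightarrow> nat \<Rightarrow> 'a::comm_ring_1) \<Rightarrow> 'a" where
  "maximal_minor_sum n k X = minor_sum k [] (map X [1..<Suc n])"

lemma maximal_minor_sum_eq_sum:
  "maximal_minor_sum n k X =
    (\<Sum>c | c \<subseteq> {1..n} \<and> card c = k. det_rows k (map X (sorted_list_of_set c)))"
proof -
  have "maximal_minor_sum n k X = (\<Sum>c\<in>Pow {1..n}.
      if card c = k then det_rows k (map X (sorted_list_of_set c)) else 0)"
    unfolding maximal_minor_sum_def
    using minor_sum_map_sorted[of "[1..<Suc n]" k "[]" X]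
    by (simp add: atLeastLessThanSuc_atLeastAtMost del: upt_Suc cong: if_cong)
  also have "\<dots> = (\<Sum>c | c \<subseteq> {1..n} \<and> card c = k. det_rows k (map X (sorted_list_of_set c)))"
    by (subst sum.inter_filter[symmetric]) simp_all
  finally show ?thesis .
qed

section \<open>Spaces of matrices\<close>

interpretation mat: vector_space "mscale :: 'a::field \<Rightarrow> _"
  by (rule vector_space_mscale)

interpretation mat_endo: vector_space_pair "mscale :: 'a::field \<Rightarrow> _" "mscale :: 'a \<Rightarrow> _" ..

lemma linear_mat_endoI:
  assumes "\<And>X Y. f (X + Y) = f X + f Y" and "\<And>c X. f (mscale c X) = mscale c (f X)"
  shows "Vector_Spaces.linear (mscale :: 'a::field \<Rightarrow> _) mscale f"
  by unfold_locales (fact assms)+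

lemma mat_spaceD: "X \<in> mat_space n k \<Longrightarrow> i \<notin> {1..n} \<or> j \<notin> {1..k} \<Longrightarrow> X i j = 0"
  unfolding mat_space_def by blast

lemma mat_space_subset_Suc: "mat_space n k \<subseteq> mat_space n (Suc k)"
  by (auto simp: mat_space_def)

lemma subspace_mat_space: "mat.subspace (mat_space n k)"
  by (auto simp: mat.subspace_def mat_space_def mscale_def)

lemmas mat_space_add = mat.subspace_add[OF subspace_mat_space]
  and mat_space_diff = mat.subspace_diff[OF subspace_mat_space]
  and mat_space_scale = mat.subspace_scale[OF subspace_mat_space]

definition unit_mat :: "nat \<Rightarrow> nat \<Rightarrow> nat \<Rightarrow> nat \<Rightarrow> 'a::zero_neq_one" where
  "unit_mat i j = (\<lambda>r c. if r = i \<and> c = j then 1 else 0)"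

definition unit_mats :: "(nat \<times> nat) set \<Rightarrow> (nat \<Rightarrow> nat \<Rightarrow> 'a::zero_neq_one) set" where
  "unit_mats A = case_prod unit_mat ` A"

lemma unit_mat_in_mat_space: "i \<in> {1..n} \<Longrightarrow> j \<in> {1..k} \<Longrightarrow> unit_mat i j \<in> mat_space n k"
  by (auto simp: mat_space_def unit_mat_def)

lemma unit_mats_subset_mat_space: "A \<subseteq> {1..n} \<times> {1..k} \<Longrightarrow> unit_mats A \<subseteq> mat_space n k"
  by (force simp: unit_mats_def intro: unit_mat_in_mat_space)

lemma inj_unit_mat: "inj (case_prod unit_mat :: _ \<Rightarrow> nat \<Rightarrow> nat \<Rightarrow> 'a::zero_neq_one)"
proof (rule injI)
  fix p q :: "nat \<times> nat"
  assume "case_prod unit_mat p = (case_prod unit_mat q :: nat \<Rightarrow> nat \<Rightarrow> 'a)"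
  then have "case_prod unit_mat p (fst p) (snd p) = (case_prod unit_mat q (fst p) (snd p) :: 'a)"
    by simp
  then show "p = q" by (auto simp: unit_mat_def split_def prod_eq_iff split: if_splits)
qed

lemma card_unit_mats: "card (unit_mats A :: (nat \<Rightarrow> nat \<Rightarrow> 'a::zero_neq_one) set) = card A"
  unfolding unit_mats_def by (intro card_image inj_on_subset[OF inj_unit_mat]) simp

lemma finite_unit_mats: "finite A \<Longrightarrow> finite (unit_mats A)"
  by (simp add: unit_mats_def)

lemma sum_mscale_unit_mat_apply:
  assumes "finite A"
  shows "(\<Sum>(r, l)\<in>A. mscale (c r l) (unit_mat r l)) i j =
    (if (i, j) \<in> A then c i j else (0 :: 'a::field))"
proof -
  have "(\<Sum>(r, l)\<in>A. mscale (c r l) (unit_mat r l)) i j = (\<Sum>p\<in>A. if p = (i, j) then c i j else 0)"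
    unfolding sum_fun_apply by (rule sum.cong) (auto simp: mscale_def unit_mat_def split: if_splits)
  then show ?thesis using assms by simp
qed

lemma sum_unit_mats_apply:
  fixes c :: "(nat \<Rightarrow> nat \<Rightarrow> 'a::field) \<Rightarrow> 'a"
  assumes "finite A"
  shows "(\<Sum>x\<in>unit_mats A. mscale (c x) x) i j = (if (i, j) \<in> A then c (unit_mat i j) else 0)"
proof -
  have "(\<Sum>x\<in>unit_mats A. mscale (c x) x) = (\<Sum>(r, l)\<in>A. mscale (c (unit_mat r l)) (unit_mat r l))"
    unfolding unit_mats_def
    by (subst sum.reindex[OF inj_on_subset[OF inj_unit_mat subset_UNIV]]) (simp add: split_def)
  then show ?thesis by (simp add: sum_mscale_unit_mat_apply[OF assms])
qed

lemma independent_unit_mats: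
  assumes "finite A"
  shows "mat.independent (unit_mats A :: (nat \<Rightarrow> nat \<Rightarrow> 'a::field) set)"
proof (rule mat.independent_if_scalars_zero)
  show "finite (unit_mats A)" using assms by (rule finite_unit_mats)
  fix c :: "(nat \<Rightarrow> nat \<Rightarrow> 'a) \<Rightarrow> 'a" and x :: "nat \<Rightarrow> nat \<Rightarrow> 'a"
  assume sum_0: "(\<Sum>x\<in>unit_mats A. mscale (c x) x) = 0" and "x \<in> unit_mats A"
  then obtain i j where x: "x = unit_mat i j" "(i, j) \<in> A" by (auto simp: unit_mats_def)
  then have "c x = (\<Sum>x\<in>unit_mats A. mscale (c x) x) i j"
    by (simp add: sum_unit_mats_apply[OF assms])
  then show "c x = 0" by (simp add: sum_0)
qed

lemma span_unit_mats:
  "mat.span (unit_mats ({1..n} \<times> {1..k})) = (mat_space n k :: (nat \<Rightarrow> nat \<Rightarrow> 'a::field) set)"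
proof (rule mat.span_subspace)
  let ?A = "{1..n} \<times> {1..k}"
  show "mat_space n k \<subseteq> mat.span (unit_mats ?A :: (nat \<Rightarrow> nat \<Rightarrow> 'a) set)"
  proof
    fix X :: "nat \<Rightarrow> nat \<Rightarrow> 'a" assume "X \<in> mat_space n k"
    then have "X = (\<Sum>(i, j)\<in>?A. mscale (X i j) (unit_mat i j))"
      by (intro ext, subst sum_mscale_unit_mat_apply) (auto simp: mat_space_def)
    also have "\<dots> \<in> mat.span (unit_mats ?A)"
      unfolding split_def unit_mats_def by (intro mat.span_sum mat.span_scale mat.span_base) auto
    finally show "X \<in> mat.span (unit_mats ?A)" .
  qed
qed (rule unit_mats_subset_mat_space subspace_mat_space subset_refl)+

lemma codim_le_mat_space:
  assumes "mat.subspace V" "V \<subseteq> mat_space n k"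
  shows "codim_le mscale (mat_space n k) V (n * k - mat.dim V)"
  using mat.codim_le_card_minus_dim[OF finite_unit_mats, of "{1..n} \<times> {1..k}" V] assms
  unfolding span_unit_mats card_unit_mats by simp

definition row_comb :: "nat \<Rightarrow> (nat \<Rightarrow> 'a) \<Rightarrow> (nat \<Rightarrow> nat \<Rightarrow> 'a) \<Rightarrow> nat \<Rightarrow> 'a::comm_semiring_0" where
  "row_comb n a X j = (\<Sum>i=1..n. a i * X i j)"

lemma row_comb_add: "row_comb n a (X + Y) j = row_comb n a X j + row_comb n a Y j"
  and row_comb_0: "row_comb n a 0 j = 0"
  by (simp_all add: row_comb_def ring_distribs sum.distrib)

lemma row_comb_scale: "row_comb n a (mscale c X) j = c * row_comb n a X j"
  by (simp add: row_comb_def mscale_def sum_distrib_left mult_ac)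

lemma linear_row_comb:
  "Vector_Spaces.linear mscale (*) (\<lambda>X. row_comb n a X j :: 'a::field)"
  by unfold_locales (auto simp: row_comb_add row_comb_scale algebra_simps)

lemma row_comb_single_column:
  "row_comb n a (\<lambda>i j. if i \<in> {1..n} \<and> j = l then x i else 0) j =
    (if j = l then \<Sum>i=1..n. a i * x i else 0)"
  by (simp add: row_comb_def)

lemma row_comb_unit_mat:
  assumes "i \<in> {1..n}"
  shows "row_comb n a (unit_mat i l) j = (if j = l then a i else (0 :: 'a::comm_semiring_1))"
proof -
  have "row_comb n a (unit_mat i l) j = (\<Sum>r=1..n. if r = i then (if j = l then a i else 0) else 0)"
    unfolding row_comb_def by (rule sum.cong) (auto simp: unit_mat_def)
  then show ?thesis using assms by simp
qed

definition annihilated_mats ::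
  "nat \<Rightarrow> nat \<Rightarrow> (nat \<Rightarrow> 'a) \<Rightarrow> (nat \<Rightarrow> nat \<Rightarrow> 'a::comm_semiring_0) set" where
  "annihilated_mats n k a = {X \<in> mat_space n k. \<forall>j\<in>{1..k}. row_comb n a X j = 0}"

lemma subspace_annihilated_mats: "mat.subspace (annihilated_mats n k (a :: nat \<Rightarrow> 'a::field))"
  using subspace_mat_space[of n k]
  by (auto simp: mat.subspace_def annihilated_mats_def row_comb_0 row_comb_add row_comb_scale)

definition complete_last_row ::
  "nat \<Rightarrow> (nat \<Rightarrow> 'a) \<Rightarrow> (nat \<Rightarrow> nat \<Rightarrow> 'a) \<Rightarrow> nat \<Rightarrow> nat \<Rightarrow> 'a::field" where
  "complete_last_row n a Y = (\<lambda>i j. if i = n then - row_comb (n - 1) a Y j / a n else Y i j)"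

lemma linear_complete_last_row: "Vector_Spaces.linear mscale mscale (complete_last_row n a)"
proof (rule linear_mat_endoI)
  show "complete_last_row n a (Y + Z) = complete_last_row n a Y + complete_last_row n a Z" for Y Z
    by (intro ext) (simp add: complete_last_row_def row_comb_add diff_divide_distrib)
  show "complete_last_row n a (mscale c Y) = mscale c (complete_last_row n a Y)" for c Y
    unfolding complete_last_row_def row_comb_scale by (intro ext) (simp add: mscale_def)
qed

lemma row_comb_Suc: "row_comb (Suc m) a X j = row_comb m a X j + a (Suc m) * X (Suc m) j"
  by (simp add: row_comb_def)

lemma row_comb_cong:
  assumes "\<And>i. i \<in> {1..n} \<Longrightarrow> X i j = Y i j"
  shows "row_comb n a X j = row_comb n a Y j"
  unfolding row_comb_def by (rule sum.cong) (use assms in auto)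

lemma complete_last_row_in_annihilated_mats:
  assumes a: "a (Suc m) \<noteq> 0" and Y: "Y \<in> mat_space m k"
  shows "complete_last_row (Suc m) a Y \<in> annihilated_mats (Suc m) k a"
proof -
  have "row_comb m a (complete_last_row (Suc m) a Y) j = row_comb m a Y j" for j
    by (rule row_comb_cong) (auto simp: complete_last_row_def)
  then have "row_comb (Suc m) a (complete_last_row (Suc m) a Y) j = 0" for j
    using a by (simp add: row_comb_Suc) (simp add: complete_last_row_def)
  moreover have "complete_last_row (Suc m) a Y \<in> mat_space (Suc m) k"
    using Y by (auto simp: complete_last_row_def mat_space_def row_comb_def)
  ultimately show ?thesis by (simp add: annihilated_mats_def)
qed

lemma bij_betw_complete_last_row:
  assumes a: "a (Suc m) \<noteq> 0"
  shows "bij_betw (complete_last_row (Suc m) a) (mat_space m k) (annihilated_mats (Suc m) k a)"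
proof (rule bij_betw_byWitness)
  let ?truncate = "\<lambda>X i j. if i = Suc m then 0 else X i j"
  have row_comb_truncate: "row_comb m a (?truncate X) j = row_comb m a X j" for X j
    by (rule row_comb_cong) auto
  show "\<forall>Y\<in>mat_space m k. ?truncate (complete_last_row (Suc m) a Y) = Y"
    by (auto simp: complete_last_row_def mat_space_def fun_eq_iff)
  show "complete_last_row (Suc m) a ` mat_space m k \<subseteq> annihilated_mats (Suc m) k a"
    using complete_last_row_in_annihilated_mats[where a = a, OF a] by blast
  show "?truncate ` annihilated_mats (Suc m) k a \<subseteq> mat_space m k"
    by (auto simp: annihilated_mats_def mat_space_def)
  show "\<forall>X\<in>annihilated_mats (Suc m) k a. complete_last_row (Suc m) a (?truncate X) = X"
  proof (intro ballI ext)
    fix X i j assume X: "X \<in> annihilated_mats (Suc m) k a"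
    have "- row_comb m a X j / a (Suc m) = X (Suc m) j"
    proof (cases "j \<in> {1..k}")
      case True
      then have "row_comb m a X j + a (Suc m) * X (Suc m) j = 0"
        using X by (simp add: annihilated_mats_def row_comb_Suc)
      then have "- row_comb m a X j = a (Suc m) * X (Suc m) j" by (simp only: neg_eq_iff_add_eq_0)
      then show ?thesis using a by simp
    next
      case False
      then show ?thesis using X by (auto simp: annihilated_mats_def mat_space_def row_comb_def)
    qed
    then show "complete_last_row (Suc m) a (?truncate X) i j = X i j"
      by (simp add: complete_last_row_def row_comb_truncate)
  qed
qed

lemma dim_annihilated_mats:
  fixes a :: "nat \<Rightarrow> 'a::field"
  assumes "a (Suc m) \<noteq> 0"
  shows "mat.dim (annihilated_mats (Suc m) k a) = m * k"
proof -
  have "complete_last_row (Suc m) a ` mat_space m k = annihilated_mats (Suc m) k a"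
    and "inj_on (complete_last_row (Suc m) a) (mat_space m k)"
    using bij_betw_complete_last_row[where m = m and k = k and a = a] assms
    by (auto simp: bij_betw_def)
  then show ?thesis
    using mat_endo.dim_image_eq_if_inj_on_span[OF linear_complete_last_row,
        of "Suc m" a "unit_mats ({1..m} \<times> {1..k})"]
    unfolding span_unit_mats card_unit_mats by (simp add: independent_unit_mats)
qed

lemma direction_translate:
  assumes "mat.subspace V"
  shows "direction ((\<lambda>v. s + v) ` V) = V"
proof
  show "direction ((\<lambda>v. s + v) ` V) \<subseteq> V"
    using mat.subspace_diff[OF assms] by (auto simp: direction_def)
  show "V \<subseteq> direction ((\<lambda>v. s + v) ` V)"
  proof
    fix v assume "v \<in> V"
    moreover have "v = (s + v) - (s + 0)" by simp
    ultimately show "v \<in> direction ((\<lambda>v. s + v) ` V)"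
      unfolding direction_def using mat.subspace_0[OF assms] by blast
  qed
qed

lemma translate_eq_if_mem:
  assumes "mat.subspace V" and "s \<in> V"
  shows "(\<lambda>v. s + v) ` V = V"
proof (intro equalityI subsetI)
  fix v assume "v \<in> V"
  then have "v - s \<in> V" using assms by (intro mat.subspace_diff)
  then show "v \<in> (\<lambda>v. s + v) ` V" by (rule rev_image_eqI) simp
qed (use assms mat.subspace_add in blast)

section \<open>The sum of the maximal minors of a matrix\<close>

lemma maximal_minor_sum_cong:
  assumes "\<And>i j. i \<in> {1..n} \<Longrightarrow> j \<in> {1..k} \<Longrightarrow> X i j = Y i j"
  shows "maximal_minor_sum n k X = maximal_minor_sum n k Y"
  unfolding maximal_minor_sum_def
  by (rule minor_sum_cong) (use assms in \<open>auto simp: list_all2_conv_all_nth nth_append\<close>)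

lemma maximal_minor_sum_mult:
  "maximal_minor_sum n k (\<lambda>i j. \<Sum>l\<in>{1..k}. X i l * g l j) = maximal_minor_sum n k X * det_k k g"
  using minor_sum_mult[of k g "[]" "map X [1..<Suc n]"]
  unfolding maximal_minor_sum_def map_map list.map(1) o_def .

lemma map_upt_skip:
  assumes "a \<le> i" "i \<le> b"
  shows "map (\<lambda>r. if r < i then f r else g (r + d)) [a..<b] = map f [a..<i] @ map g [i + d..<b + d]"
proof -
  have "[a..<b] = [a..<i] @ [i..<b]"
    using assms upt_add_eq_append[of a i "b - i"] by simp
  moreover have "map (\<lambda>r. if r < i then f r else g (r + d)) [i..<b] = map g [i + d..<b + d]"
    by (intro nth_equalityI) (auto simp: add_ac)
  ultimately show ?thesis by simp
qed

lemma maximal_minor_sum_eq_det_k: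
  assumes "k \<le> n" and "\<And>i j. i \<in> {Suc k..n} \<Longrightarrow> j \<in> {1..k} \<Longrightarrow> X i j = 0"
  shows "maximal_minor_sum n k X = det_k k X"
proof -
  have "maximal_minor_sum n k X = maximal_minor_sum n k (\<lambda>i. if i < Suc k then X i else 0)"
    by (rule maximal_minor_sum_cong) (use assms in auto)
  also have "map (\<lambda>i. if i < Suc k then X i else 0) [1..<Suc n] =
      map X [1..<Suc k] @ replicate (n - k) 0"
    using map_upt_skip[of 1 "Suc k" "Suc n" X "\<lambda>_. 0" 0] assms(1)
    by (simp add: map_replicate_const del: upt_Suc)
  then have "maximal_minor_sum n k (\<lambda>i. if i < Suc k then X i else 0) =
      minor_sum k [] (map X [1..<Suc k])"
    by (simp only: maximal_minor_sum_def minor_sum_append_zeros)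
  also have "\<dots> = det_rows k (map X [1..<Suc k])"
    by (simp add: minor_sum_eq_det_rows del: upt_Suc)
  also have "\<dots> = det_k k X"
    unfolding det_rows_def by (rule det_k_cong) (auto simp del: upt_Suc)
  finally show ?thesis .
qed

lemma maximal_minor_sum_identity:
  assumes "k \<le> n"
  shows "maximal_minor_sum n k (\<lambda>i j. if i = j then 1 else 0) = 1"
  by (subst maximal_minor_sum_eq_det_k) (use assms in \<open>auto simp: det_k_identity\<close>)

lemma maximal_minor_sum_cancel_opposite:
  assumes i: "i \<in> {1..<n}" and X: "\<And>j. j \<in> {1..k} \<Longrightarrow> X (Suc i) j = - X i j"
  shows "maximal_minor_sum n k X =
    maximal_minor_sum (n - 2) k (\<lambda>r. if r < i then X r else X (r + 2))"
proof -
  define Y where "Y = X(Suc i := \<lambda>j. - X i j)"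
  have split: "[1..<Suc n] = [1..<i] @ i # Suc i # [i + 2..<Suc n]"
    using i upt_add_eq_append[of 1 i "Suc n - i"] by (simp add: upt_conv_Cons)
  have "maximal_minor_sum n k X = maximal_minor_sum n k Y"
    by (rule maximal_minor_sum_cong) (auto simp: Y_def X)
  also have "\<dots> = minor_sum k [] (map X [1..<i] @ X i # (\<lambda>j. - X i j) # map X [i + 2..<Suc n])"
    unfolding maximal_minor_sum_def split by (simp add: Y_def)
  also have "\<dots> = minor_sum k [] (map X [1..<i] @ map X [i + 2..<Suc n])"
    by (rule minor_sum_cancel_opposite)
  also have "map X [1..<i] @ map X [i + 2..<Suc n] =
      map (\<lambda>r. if r < i then X r else X (r + 2)) [1..<Suc (n - 2)]"
    using i map_upt_skip[of 1 i "Suc (n - 2)" X X 2] by (cases n) (auto simp: Suc_diff_le)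
  finally show ?thesis unfolding maximal_minor_sum_def .
qed

definition signed_delete_row :: "nat \<Rightarrow> (nat \<Rightarrow> nat \<Rightarrow> 'a::uminus) \<Rightarrow> nat \<Rightarrow> nat \<Rightarrow> 'a" where
  "signed_delete_row i X = (\<lambda>r j. if r < i then - X r j else X (Suc r) j)"

lemma maximal_minor_sum_last_column:
  assumes i: "i \<in> {1..Suc m}" and X: "\<And>r. r \<in> {1..Suc m} \<Longrightarrow> r \<noteq> i \<Longrightarrow> X r (Suc k) = 0"
  shows "maximal_minor_sum (Suc m) (Suc k) X =
    (-1) ^ k * X i (Suc k) * maximal_minor_sum m k (signed_delete_row i X)"
proof -
  have "[1..<Suc (Suc m)] = [1..<i] @ i # [Suc i..<Suc (Suc m)]"
    using i upt_add_eq_append[of 1 i "Suc (Suc m) - i"] by (simp add: upt_conv_Cons)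
  then have "maximal_minor_sum (Suc m) (Suc k) X =
      minor_sum (Suc k) [] (map X [1..<i] @ X i # map X [Suc i..<Suc (Suc m)])"
    by (simp add: maximal_minor_sum_def)
  also have "\<dots> = (-1) ^ k * X i (Suc k)
      * minor_sum k [] (map (\<lambda>p j. - p j) (map X [1..<i]) @ map X [Suc i..<Suc (Suc m)])"
    by (rule minor_sum_last_column) (use X i in auto)
  also have "signed_delete_row i X = (\<lambda>r. if r < i then \<lambda>j. - X r j else X (r + 1))"
    by (auto simp: signed_delete_row_def fun_eq_iff)
  then have "map (\<lambda>p j. - p j) (map X [1..<i]) @ map X [Suc i..<Suc (Suc m)] =
      map (signed_delete_row i X) [1..<Suc m]"
    using i map_upt_skip[of 1 i "Suc m" "\<lambda>r j. - X r j" X 1] by (simp add: o_def del: upt_Suc)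
  finally show ?thesis by (simp only: maximal_minor_sum_def)
qed

lemma sum_list_map_upt_apply: "sum_list (map X [1..<Suc n]) j = (\<Sum>i = 1..n. X i j)"
  by (induction n) auto

lemma maximal_minor_sum_odd_eq_0:
  assumes "odd k" and X: "X \<in> annihilated_mats n k (\<lambda>_. 1)"
  shows "maximal_minor_sum n k X = 0"
  unfolding maximal_minor_sum_def
proof (rule minor_sum_odd_eq_0[OF assms(1)], rule ext)
  show "sum_list (map X [1..<Suc n]) j = 0 j" for j
    unfolding sum_list_map_upt_apply
    using X by (cases "j \<in> {1..k}") (auto simp: annihilated_mats_def row_comb_def mat_space_def)
qed

lemma maximal_minor_sum_even_ne_0:
  assumes "even k" and "k < n"
  obtains X where "X \<in> annihilated_mats n k (\<lambda>_. 1 :: 'a::comm_ring_1)"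
    and "maximal_minor_sum n k X = 1"
proof
  define m where "m = n - 1"
  then have n: "n = Suc m" using assms(2) by simp
  define Y :: "nat \<Rightarrow> nat \<Rightarrow> 'a" where "Y i j = (if i = j \<and> j \<in> {1..k} then 1 else 0)" for i j
  define X where "X i j = (if i = 1 then - (\<Sum>r = 1..m. Y r j) else Y (i - 1) j)" for i j
  have X_Suc: "X (Suc i) = Y i" if "i \<in> {1..m}" for i
    using that by (auto simp: X_def)
  have "row_comb n (\<lambda>_. 1) X j = X 1 j + (\<Sum>i = 1..m. X (Suc i) j)" for j
    unfolding row_comb_def n
    by (simp add: sum.atLeast_Suc_atMost sum.shift_bounds_cl_Suc_ivl del: sum.cl_ivl_Suc)
  then have "row_comb n (\<lambda>_. 1) X j = 0" for j
    using X_Suc by (simp add: X_def)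
  moreover have "X \<in> mat_space n k"
    using assms(2) by (auto simp: X_def Y_def mat_space_def)
  ultimately show "X \<in> annihilated_mats n k (\<lambda>_. 1)" by (simp add: annihilated_mats_def)
  have "map X [1..<Suc n] = X 1 # map (X \<circ> Suc) [1..<Suc m]"
    by (simp add: n upt_conv_Cons map_Suc_upt[symmetric] del: upt_Suc)
  also have "map (X \<circ> Suc) [1..<Suc m] = map Y [1..<Suc m]"
    by (rule map_cong) (use X_Suc in auto)
  also have "X 1 = (\<lambda>j. - sum_list (map Y [1..<Suc m]) j)"
    unfolding sum_list_map_upt_apply by (simp add: X_def fun_eq_iff)
  finally have "maximal_minor_sum n k X = maximal_minor_sum m k Y"
    by (simp only: maximal_minor_sum_def minor_sum_even_Cons_uminus_sum_list[OF assms(1)])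
  also have "\<dots> = maximal_minor_sum m k (\<lambda>i j. if i = j then 1 else 0)"
    by (rule maximal_minor_sum_cong) (auto simp: Y_def)
  also have "\<dots> = 1"
    using assms(2) n by (intro maximal_minor_sum_identity) auto
  finally show "maximal_minor_sum n k X = 1" .
qed

definition alternate_rows :: "(nat \<Rightarrow> nat \<Rightarrow> 'a::comm_ring_1) \<Rightarrow> nat \<Rightarrow> nat \<Rightarrow> 'a" where
  "alternate_rows X = (\<lambda>i j. (-1) ^ i * X i j)"

lemma alternate_rows_alternate_rows: "alternate_rows (alternate_rows X) = X"
  by (simp add: alternate_rows_def mult.assoc[symmetric] power_mult_distrib[symmetric])

lemma alternate_rows_in_mat_space_iff: "alternate_rows X \<in> mat_space n k \<longleftrightarrow> X \<in> mat_space n k"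
proof -
  have "alternate_rows Y \<in> mat_space n k" if "Y \<in> mat_space n k" for Y :: "nat \<Rightarrow> nat \<Rightarrow> 'a"
    using that by (auto simp: alternate_rows_def mat_space_def)
  then show ?thesis by (metis alternate_rows_alternate_rows)
qed

lemma alternate_rows_in_annihilated_mats_iff:
  "alternate_rows X \<in> annihilated_mats n k (\<lambda>_. 1) \<longleftrightarrow> X \<in> annihilated_mats n k (\<lambda>i. (-1) ^ i)"
  by (simp add: annihilated_mats_def row_comb_def alternate_rows_in_mat_space_iff)
    (simp add: alternate_rows_def)

lemma linear_alternate_rows:
  "Vector_Spaces.linear mscale mscale (alternate_rows :: (nat \<Rightarrow> nat \<Rightarrow> 'a::field) \<Rightarrow> _)"
  by (rule linear_mat_endoI) (auto simp: alternate_rows_def mscale_def fun_eq_iff algebra_simps)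

lemma elem_of_ge:
  assumes c: "c \<subseteq> {1..n}" "card c = k" and \<alpha>: "\<alpha> \<in> {1..k}"
  shows "\<alpha> \<le> elem_of c \<alpha>"
proof -
  have "finite c" using c finite_subset by blast
  then have "sorted_wrt (<) (0 # sorted_list_of_set c)"
    using c by (auto simp: strict_sorted_iff)
  then have "\<alpha> \<le> (0 # sorted_list_of_set c) ! \<alpha>"
    using \<alpha> c(2) by (intro sorted_wrt_less_idx) auto
  then show ?thesis using \<alpha> by (simp add: elem_of_def nth_Cons')
qed

lemma det_rows_alternate_rows:
  assumes c: "c \<subseteq> {1..n}" "card c = k"
  shows "det_rows k (map (alternate_rows X) (sorted_list_of_set c)) =
    (-1) ^ (\<Sum>{1..k}) * (of_int (sgn_sub k c) * det_k k (rows_sub X c))"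
proof -
  have "finite c" using c finite_subset by blast
  then have "det_rows k (map (alternate_rows X) (sorted_list_of_set c)) =
      det_k k (\<lambda>\<alpha> j. (-1) ^ elem_of c \<alpha> * rows_sub X c \<alpha> j)"
    unfolding det_rows_def
    by (intro det_k_cong) (use c in \<open>auto simp: elem_of_def rows_sub_def alternate_rows_def\<close>)
  also have "\<dots> = (-1) ^ (\<Sum>\<alpha>\<in>{1..k}. elem_of c \<alpha>) * det_k k (rows_sub X c)"
    by (simp only: det_k_scale_rows power_sum)
  also have "(\<Sum>\<alpha>\<in>{1..k}. elem_of c \<alpha>) = \<Sum>{1..k} + (\<Sum>\<alpha>\<in>{1..k}. elem_of c \<alpha> - \<alpha>)"
    unfolding sum.distrib[symmetric] using elem_of_ge[OF c] by (intro sum.cong) auto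
  finally show ?thesis by (simp add: sgn_sub_def power_add mult.assoc)
qed

lemma maximal_minor_sum_alternate_rows:
  "maximal_minor_sum n k (alternate_rows X) = (-1) ^ (\<Sum>{1..k}) * cullis_det n k X"
  unfolding maximal_minor_sum_eq_sum cullis_det_def sum_distrib_left
  by (rule sum.cong) (auto simp: det_rows_alternate_rows)

lemma cullis_det_eq_0_iff: "cullis_det n k X = 0 \<longleftrightarrow> maximal_minor_sum n k (alternate_rows X) = 0"
proof -
  have "cullis_det n k X = (-1) ^ (\<Sum>{1..k}) * maximal_minor_sum n k (alternate_rows X)"
    by (simp add: maximal_minor_sum_alternate_rows mult.assoc[symmetric]
        power_mult_distrib[symmetric])
  then show ?thesis using maximal_minor_sum_alternate_rows[of n k X] by (metis mult_zero_right)
qed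

section \<open>Deleting rows and mixing columns\<close>

lemma linear_signed_delete_row:
  "Vector_Spaces.linear mscale mscale (signed_delete_row i :: (nat \<Rightarrow> nat \<Rightarrow> 'a::field) \<Rightarrow> _)"
proof (rule linear_mat_endoI)
  show "signed_delete_row i (X + Y) = signed_delete_row i X + signed_delete_row i Y"
    for X Y :: "nat \<Rightarrow> nat \<Rightarrow> 'a"
    by (intro ext) (simp add: signed_delete_row_def)
  show "signed_delete_row i (mscale c X) = mscale c (signed_delete_row i X)"
    for c and X :: "nat \<Rightarrow> nat \<Rightarrow> 'a"
    by (intro ext) (simp add: signed_delete_row_def mscale_def)
qed

lemma signed_delete_row_image_mat_space:
  assumes i: "i \<in> {1..Suc m}"
  shows "signed_delete_row i ` mat_space (Suc m) k = (mat_space m k :: (nat \<Rightarrow> nat \<Rightarrow> 'a::field) set)"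
proof (intro equalityI subsetI)
  fix Y :: "nat \<Rightarrow> nat \<Rightarrow> 'a" assume "Y \<in> signed_delete_row i ` mat_space (Suc m) k"
  then show "Y \<in> mat_space m k"
    using i by (auto simp: mat_space_def signed_delete_row_def)
next
  fix Y :: "nat \<Rightarrow> nat \<Rightarrow> 'a" assume Y: "Y \<in> mat_space m k"
  define X where "X r c = (if r = i then 0 else if r < i then - Y r c else Y (r - 1) c)" for r c
  have "Y (r - 1) c = 0" if "Suc m < r" for r c
    using that by (intro mat_spaceD[OF Y]) auto
  then have "X \<in> mat_space (Suc m) k"
    using Y i by (auto simp: X_def mat_space_def)
  moreover have "Y = signed_delete_row i X"
    by (intro ext) (simp add: signed_delete_row_def X_def)
  ultimately show "Y \<in> signed_delete_row i ` mat_space (Suc m) k" by blast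
qed

lemma signed_delete_row_in_mat_space:
  fixes X :: "nat \<Rightarrow> nat \<Rightarrow> 'a::group_add"
  assumes i: "i \<in> {1..Suc m}" and X: "X \<in> mat_space (Suc m) (Suc k)"
    and last_column: "\<And>r. r \<in> {1..Suc m} \<Longrightarrow> r \<noteq> i \<Longrightarrow> X r (Suc k) = 0"
  shows "signed_delete_row i X \<in> mat_space m k"
proof -
  have "X r c = 0" if "r \<notin> {1..Suc m} \<or> c \<notin> {1..k} \<and> r \<noteq> i" for r c
    using that last_column[of r] mat_spaceD[OF X, of r c] by (cases "c = Suc k") auto
  then show ?thesis using i by (auto simp: mat_space_def signed_delete_row_def)
qed

lemma signed_delete_row_unit_mat:
  "signed_delete_row i (unit_mat i j) = (0 :: nat \<Rightarrow> nat \<Rightarrow> 'a::ring_1)"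
  by (intro ext) (simp add: signed_delete_row_def unit_mat_def)

lemma row_comb_signed_delete_row:
  fixes X :: "nat \<Rightarrow> nat \<Rightarrow> 'a::comm_ring_1"
  assumes i: "i \<in> {1..Suc m}"
  shows "row_comb m (\<lambda>_. 1) (signed_delete_row i X) j =
    (\<Sum>r=Suc i..Suc m. X r j) - (\<Sum>r=1..<i. X r j)"
proof -
  have "{1..m} = {1..<i} \<union> {i..m}" using i by auto
  then have "row_comb m (\<lambda>_. 1) (signed_delete_row i X) j =
      (\<Sum>r=1..<i. signed_delete_row i X r j) + (\<Sum>r=i..m. signed_delete_row i X r j)"
    unfolding row_comb_def by (simp add: sum.union_disjoint[symmetric] ivl_disj_int)
  also have "(\<Sum>r=1..<i. signed_delete_row i X r j) = - (\<Sum>r=1..<i. X r j)"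
    by (simp add: signed_delete_row_def sum_negf)
  also have "(\<Sum>r=i..m. signed_delete_row i X r j) = (\<Sum>r=Suc i..Suc m. X r j)"
    unfolding sum.shift_bounds_cl_Suc_ivl by (simp add: signed_delete_row_def)
  finally show ?thesis by simp
qed

lemma row_comb_signed_delete_row_diff:
  fixes X :: "nat \<Rightarrow> nat \<Rightarrow> 'a::comm_ring_1"
  assumes i: "i \<in> {1..m}"
  shows "row_comb m (\<lambda>_. 1) (signed_delete_row i X) j -
    row_comb m (\<lambda>_. 1) (signed_delete_row (Suc i) X) j = X i j + X (Suc i) j"
proof -
  have "(\<Sum>r=Suc i..Suc m. X r j) = X (Suc i) j + (\<Sum>r=Suc (Suc i)..Suc m. X r j)"
    using i by (intro sum.atLeast_Suc_atMost) auto
  then show ?thesis using i by (simp add: row_comb_signed_delete_row del: sum.cl_ivl_Suc)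
qed

lemma row_comb_signed_delete_row_unit_mat:
  assumes i: "i \<in> {1..Suc m}" and r: "r \<in> {1..Suc m}" "r \<noteq> i"
  shows "row_comb m (\<lambda>_. 1) (signed_delete_row i (unit_mat r j)) j =
    (if i < r then 1 else - (1 :: 'a::comm_ring_1))"
  unfolding row_comb_signed_delete_row[OF i] unit_mat_def
  using i r by (auto simp del: sum.cl_ivl_Suc)

definition mix_columns ::
  "nat \<Rightarrow> nat \<Rightarrow> (nat \<Rightarrow> 'a) \<Rightarrow> (nat \<Rightarrow> nat \<Rightarrow> 'a) \<Rightarrow> nat \<Rightarrow> nat \<Rightarrow> 'a::comm_semiring_0" where
  "mix_columns k j w X =
    (\<lambda>r c. if c = k then \<Sum>l=1..k. w l * X r l else if c = j then X r k else X r c)"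

lemma linear_mix_columns:
  "Vector_Spaces.linear mscale mscale (mix_columns k j w :: (nat \<Rightarrow> nat \<Rightarrow> 'a::field) \<Rightarrow> _)"
proof (rule linear_mat_endoI)
  show "mix_columns k j w (X + Y) = mix_columns k j w X + mix_columns k j w Y"
    for X Y :: "nat \<Rightarrow> nat \<Rightarrow> 'a"
    by (intro ext) (simp add: mix_columns_def ring_distribs sum.distrib)
  show "mix_columns k j w (mscale c X) = mscale c (mix_columns k j w X)"
    for c and X :: "nat \<Rightarrow> nat \<Rightarrow> 'a"
    by (intro ext) (simp add: mix_columns_def mscale_def sum_distrib_left mult_ac)
qed

lemma mix_columns_image_mat_space:
  assumes j: "j \<in> {1..k}" and w: "w j \<noteq> 0"
  shows "mix_columns k j w ` mat_space n k = (mat_space n k :: (nat \<Rightarrow> nat \<Rightarrow> 'a::field) set)"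
proof (intro equalityI subsetI)
  fix Y :: "nat \<Rightarrow> nat \<Rightarrow> 'a" assume "Y \<in> mix_columns k j w ` mat_space n k"
  then show "Y \<in> mat_space n k"
    using j by (auto simp: mat_space_def mix_columns_def)
next
  fix Y :: "nat \<Rightarrow> nat \<Rightarrow> 'a" assume Y: "Y \<in> mat_space n k"
  define Z where "Z r c = (if c = k then Y r j else Y r c)" for r c
  define X where
    "X r c = (if c = j then (Y r k - (\<Sum>l\<in>{1..k} - {j}. w l * Z r l)) / w j else Z r c)" for r c
  have "Z r c = 0" if "r \<notin> {1..n} \<or> c \<notin> {1..k}" for r c
    using that j mat_spaceD[OF Y, of r] by (auto simp: Z_def)
  then have "X \<in> mat_space n k"
    using j mat_spaceD[OF Y] unfolding mat_space_def X_def by simp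
  moreover have "(\<Sum>l=1..k. w l * X r l) = Y r k" for r
  proof -
    have "(\<Sum>l=1..k. w l * X r l) = w j * X r j + (\<Sum>l\<in>{1..k} - {j}. w l * Z r l)"
      using j by (subst sum.remove[of _ j]) (auto simp: X_def)
    then show ?thesis using w by (simp add: X_def)
  qed
  then have "mix_columns k j w X = Y"
    by (intro ext) (simp add: mix_columns_def, simp add: X_def Z_def)
  ultimately show "Y \<in> mix_columns k j w ` mat_space n k" by blast
qed

lemma maximal_minor_sum_mix_columns:
  assumes j: "j \<in> {1..k}"
  shows "\<exists>d. \<forall>X. maximal_minor_sum n k (mix_columns k j w X) = maximal_minor_sum n k X * d"
proof (intro exI allI)
  fix X
  let ?g = "\<lambda>l c. if c = k then w l else if l = (if c = j then k else c) then 1 else 0"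
  have "maximal_minor_sum n k (mix_columns k j w X) =
      maximal_minor_sum n k (\<lambda>r c. \<Sum>l\<in>{1..k}. X r l * ?g l c)"
  proof (rule maximal_minor_sum_cong)
    fix r c assume c: "c \<in> {1..k}"
    show "mix_columns k j w X r c = (\<Sum>l\<in>{1..k}. X r l * ?g l c)"
    proof (cases "c = k")
      case False
      have "(\<Sum>l\<in>{1..k}. X r l * ?g l c) =
          (\<Sum>l\<in>{1..k}. if l = (if c = j then k else c) then X r (if c = j then k else c) else 0)"
        by (rule sum.cong) (use False in auto)
      then show ?thesis using c False by (simp add: mix_columns_def)
    qed (simp add: mix_columns_def mult.commute)
  qed
  then show "maximal_minor_sum n k (mix_columns k j w X) = maximal_minor_sum n k X * det_k k ?g"
    by (simp only: maximal_minor_sum_mult)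
qed

lemma row_comb_mix_columns:
  "row_comb n a (mix_columns k j w X) k = (\<Sum>l=1..k. w l * row_comb n a X l)"
  unfolding row_comb_def mix_columns_def
  by (simp add: sum_distrib_left mult.left_commute) (rule sum.swap)

section \<open>Cosets of small codimension on which the form vanishes\<close>

locale vanishing_coset =
  fixes n k :: nat and s :: "nat \<Rightarrow> nat \<Rightarrow> 'a::field" and V :: "(nat \<Rightarrow> nat \<Rightarrow> 'a) set"
  assumes enough_rows: "k + 2 \<le> n"
    and s: "s \<in> mat_space n k"
    and subspace: "mat.subspace V" and V: "V \<subseteq> mat_space n k"
    and codim: "codim_le mscale (mat_space n k) V k"
    and vanish: "\<And>v. v \<in> V \<Longrightarrow> maximal_minor_sum n k (s + v) = 0"
begin

lemma add_in_mat_space: "v \<in> V \<Longrightarrow> s + v \<in> mat_space n k"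
  using s V by (auto intro: mat_space_add)

lemma vanishing_coset_image:
  assumes linear: "Vector_Spaces.linear mscale mscale f" and f: "f ` mat_space n k = mat_space n k"
    and vanish_f: "\<And>X. maximal_minor_sum n k X = 0 \<Longrightarrow> maximal_minor_sum n k (f X) = 0"
  shows "vanishing_coset n k (f s) (f ` V)"
proof
  show "f s \<in> mat_space n k" "f ` V \<subseteq> mat_space n k" using f s V by auto
  show "mat.subspace (f ` V)" by (rule mat_endo.linear_subspace_image[OF linear subspace])
  show "codim_le mscale (mat_space n k) (f ` V) k"
    by (rule mat_endo.codim_le_image[OF linear _ codim]) (simp add: f)
  show "maximal_minor_sum n k (f s + w) = 0" if "w \<in> f ` V" for w
    using that vanish_f[OF vanish] by (auto simp: mat_endo.linear_add[OF linear, symmetric])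
qed (rule enough_rows)

end

lemma codim_le_signed_delete_row_image:
  assumes subspace: "mat.subspace V" and codim: "codim_le mscale (mat_space (Suc m) k) V (Suc d)"
    and i: "i \<in> {1..Suc m}" and j: "j \<in> {1..k}" and pivot: "unit_mat i j \<notin> V"
  shows "codim_le mscale (mat_space m k)
    (signed_delete_row i ` (V \<inter> mat_space (Suc m) k) :: (nat \<Rightarrow> nat \<Rightarrow> 'a::field) set) d"
proof -
  let ?del = "signed_delete_row i :: (nat \<Rightarrow> nat \<Rightarrow> 'a) \<Rightarrow> nat \<Rightarrow> nat \<Rightarrow> 'a"
  let ?W = "V \<inter> mat_space (Suc m) k"
  note linear = linear_signed_delete_row[of i, where 'a = 'a]
  have W: "mat.subspace ?W" by (intro mat.subspace_inter subspace subspace_mat_space)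
  have "codim_le mscale (mat_space (Suc m) k) ?W (Suc d)"
    by (intro mat.codim_le_Int codim subspace_mat_space)
  then have "codim_le mscale (mat_space (Suc m) k) (mat.span (insert (unit_mat i j) ?W)) d"
    using W i j pivot by (intro mat.codim_le_span_insert) (auto intro: unit_mat_in_mat_space)
  then have "codim_le mscale (mat_space m k) (?del ` mat.span (insert (unit_mat i j) ?W)) d"
    by (rule mat_endo.codim_le_image[OF linear
        eq_refl[OF signed_delete_row_image_mat_space[OF i, symmetric]]])
  moreover have "?del ` mat.span (insert (unit_mat i j) ?W) = ?del ` ?W"
    using mat_endo.linear_subspace_image[OF linear W]
    by (simp add: mat_endo.linear_span_image[OF linear, symmetric] signed_delete_row_unit_mat)
  ultimately show ?thesis by simp
qed

lemma vanishing_coset_signed_delete_row: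
  assumes coset: "vanishing_coset (Suc m) (Suc k) s V"
    and i: "i \<in> {1..Suc m}" and j: "j \<in> {1..k}" and pivot: "unit_mat i j \<notin> V" and v: "v \<in> V"
    and last_column: "\<And>r. r \<in> {1..Suc m} \<Longrightarrow> (s + v) r (Suc k) = (if r = i then 1 else 0)"
  shows "vanishing_coset m k (signed_delete_row i (s + v))
    (signed_delete_row i ` (V \<inter> mat_space (Suc m) k))"
proof -
  interpret vanishing_coset "Suc m" "Suc k" s V by (rule coset)
  let ?del = "signed_delete_row i :: (nat \<Rightarrow> nat \<Rightarrow> 'a) \<Rightarrow> nat \<Rightarrow> nat \<Rightarrow> 'a"
  let ?W = "V \<inter> mat_space (Suc m) k"
  note linear = linear_signed_delete_row[of i, where 'a = 'a]
  have W: "mat.subspace ?W" by (intro mat.subspace_inter subspace subspace_mat_space)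
  have codim_W: "codim_le mscale (mat_space m k) (?del ` ?W) k"
    by (intro codim_le_signed_delete_row_image[OF subspace _ i j pivot]
        codim_le_subset[OF codim mat_space_subset_Suc])
  have vanish_W: "maximal_minor_sum m k (?del (s + v) + ?del w) = 0" if w: "w \<in> ?W" for w
  proof -
    have w_last: "w r (Suc k) = 0" for r using w by (intro mat_spaceD[of w "Suc m" k]) auto
    have "0 = maximal_minor_sum (Suc m) (Suc k) (s + (v + w))"
      using vanish mat.subspace_add[OF subspace v] w by simp
    also have "\<dots> = (-1) ^ k * (s + (v + w)) i (Suc k) * maximal_minor_sum m k (?del (s + (v + w)))"
      by (rule maximal_minor_sum_last_column[OF i]) (use last_column w_last in simp)
    also have "(s + (v + w)) i (Suc k) = 1" using last_column[OF i] w_last by simp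
    also have "?del (s + (v + w)) = ?del (s + v) + ?del w"
      unfolding add.assoc[symmetric] by (rule mat_endo.linear_add[OF linear])
    finally show ?thesis by (simp del: plus_fun_apply)
  qed
  show ?thesis
  proof
    show "k + 2 \<le> m" using enough_rows by simp
    show "?del (s + v) \<in> mat_space m k"
      by (rule signed_delete_row_in_mat_space[OF i add_in_mat_space[OF v]])
        (simp only: last_column if_False)
    show "?del ` ?W \<subseteq> mat_space m k"
      using signed_delete_row_image_mat_space[OF i] by blast
  qed (use codim_W vanish_W mat_endo.linear_subspace_image[OF linear W] in auto)
qed

context vanishing_coset
begin

lemma direction_eq_if_column_annihilators:
  assumes nonzero: "\<And>l. l \<in> {1..k} \<Longrightarrow> \<exists>i\<in>{1..n}. a l i \<noteq> 0"
    and annihilates: "\<And>l v. l \<in> {1..k} \<Longrightarrow> v \<in> V \<Longrightarrow> row_comb n (a l) v l = 0"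
  shows "V = {X \<in> mat_space n k. \<forall>l\<in>{1..k}. row_comb n (a l) X l = 0}"
proof (intro equalityI subsetI)
  fix X
  assume X: "X \<in> {X \<in> mat_space n k. \<forall>l\<in>{1..k}. row_comb n (a l) X l = 0}"
  obtain \<rho> where \<rho>: "\<And>l. l \<in> {1..k} \<Longrightarrow> \<rho> l \<in> {1..n} \<and> a l (\<rho> l) \<noteq> 0"
    using nonzero by metis
  show "X \<in> V"
  proof (rule mat.mem_subspace_if_functionals_eq_0[where J = "{1..k}"
        and u = "\<lambda>l. unit_mat (\<rho> l) l" and \<phi> = "\<lambda>l X. row_comb n (a l) X l"
        and W = "mat_space n k"])
    show "codim_le mscale (mat_space n k) V (card {1..k})" using codim by simp
    show "unit_mat (\<rho> l) l \<in> mat_space n k" if "l \<in> {1..k}" for l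
      using \<rho>[OF that] that by (intro unit_mat_in_mat_space) auto
  qed (use X \<rho> annihilates in \<open>auto simp: subspace linear_row_comb row_comb_unit_mat\<close>)
qed (use annihilates V in auto)

lemma proportional_to_column_annihilator:
  assumes V_eq: "V = {X \<in> mat_space n k. \<forall>l\<in>{1..k}. row_comb n (a l) X l = 0}"
    and l: "l \<in> {1..k}" and a: "\<exists>i\<in>{1..n}. a l i \<noteq> 0" and b: "\<exists>i\<in>{1..n}. b i \<noteq> 0"
    and w: "w l \<noteq> 0" and b_V: "\<And>v. v \<in> V \<Longrightarrow> (\<Sum>c=1..k. w c * row_comb n b v c) = 0"
  obtains \<mu> where "\<mu> \<noteq> 0" "\<And>i. i \<in> {1..n} \<Longrightarrow> b i = \<mu> * a l i"
proof -
  have "(\<Sum>i=1..n. b i * x i) = 0" if x: "(\<Sum>i=1..n. a l i * x i) = 0" for x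
  proof -
    let ?X = "\<lambda>i j. if i \<in> {1..n} \<and> j = l then x i else 0"
    have "?X \<in> mat_space n k" using l by (auto simp: mat_space_def)
    moreover have "row_comb n (a c) ?X c = 0" for c
      unfolding row_comb_single_column using x by (cases "c = l") simp_all
    ultimately have "?X \<in> V" unfolding V_eq by blast
    then have "0 = (\<Sum>c=1..k. w c * row_comb n b ?X c)" by (simp only: b_V)
    also have "\<dots> = (\<Sum>c=1..k. if c = l then w l * (\<Sum>i=1..n. b i * x i) else 0)"
      unfolding row_comb_single_column by (rule sum.cong) auto
    also have "\<dots> = w l * (\<Sum>i=1..n. b i * x i)" using l by simp
    finally show ?thesis using w by simp
  qed
  then show thesis
    using proportional_if_annihilator_subset[OF finite_atLeastAtMost a b] that by blast
qed

lemma maximal_minor_sum_eq_0_if_diff_mem: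
  assumes "X - s \<in> V"
  shows "maximal_minor_sum n k X = 0"
  using vanish[OF assms] by (simp add: algebra_simps)

lemma maximal_minor_sum_eq_0_if_row_comb_eq:
  assumes V_eq: "V = annihilated_mats n k a" and X: "X \<in> mat_space n k"
    and eq: "\<And>j. j \<in> {1..k} \<Longrightarrow> row_comb n a X j = row_comb n a s j"
  shows "maximal_minor_sum n k X = 0"
proof (rule maximal_minor_sum_eq_0_if_diff_mem)
  have "row_comb n a (X - s) j = row_comb n a X j - row_comb n a s j" for j
    using row_comb_add[of n a "X - s" s j] by simp
  then show "X - s \<in> V"
    unfolding V_eq annihilated_mats_def using X s eq by (auto intro: mat_space_diff)
qed

text \<open>Rows \<open>y\<close>, \<open>- y\<close> in positions \<open>i\<close>, \<open>i + 1\<close> do not influence the form, but if \<open>a i \<noteq> a (i + 1)\<close>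
  a suitable \<open>y\<close> compensates for an arbitrary choice of the other rows.\<close>

lemma adjacent_coefficients_eq:
  assumes V_eq: "V = annihilated_mats n k a" and i: "i \<in> {1..<n}"
  shows "a i = a (Suc i)"
proof (rule ccontr)
  assume neq: "a i \<noteq> a (Suc i)"
  define W :: "nat \<Rightarrow> nat \<Rightarrow> 'a" where
    "W r j = (if j \<in> {1..k} \<and> (r < i \<and> r = j \<or> Suc i < r \<and> r = j + 2) then 1 else 0)" for r j
  define y where
    "y j = (if j \<in> {1..k} then (row_comb n a s j - row_comb n a W j) / (a i - a (Suc i)) else 0)"
    for j
  define X where "X r j = W r j + (if r = i then y j else 0) + (if r = Suc i then - y j else 0)"
    for r j
  have "X \<in> mat_space n k"
    using i enough_rows by (auto simp: mat_space_def X_def W_def y_def)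
  moreover have "row_comb n a X j = row_comb n a s j" if j: "j \<in> {1..k}" for j
  proof -
    have "row_comb n a X j = (\<Sum>r=1..n. a r * W r j + (if r = i then a i * y j else 0)
        + (if r = Suc i then - a (Suc i) * y j else 0))"
      unfolding row_comb_def by (rule sum.cong) (auto simp: X_def algebra_simps)
    also have "\<dots> = row_comb n a W j + (a i - a (Suc i)) * y j"
      using i by (simp add: row_comb_def sum.distrib algebra_simps)
    also have "\<dots> = row_comb n a s j" using neq j by (simp add: y_def)
    finally show ?thesis .
  qed
  ultimately have "0 = maximal_minor_sum n k X"
    using maximal_minor_sum_eq_0_if_row_comb_eq[OF V_eq] by simp
  also have "\<dots> = maximal_minor_sum (n - 2) k (\<lambda>r. if r < i then X r else X (r + 2))"
    by (rule maximal_minor_sum_cancel_opposite[OF i]) (auto simp: X_def W_def)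
  also have "\<dots> = maximal_minor_sum (n - 2) k (\<lambda>r j. if r = j then 1 else 0)"
    by (rule maximal_minor_sum_cong) (auto simp: X_def W_def)
  also have "\<dots> = 1"
    using enough_rows by (intro maximal_minor_sum_identity) auto
  finally show False by simp
qed

lemma direction_eq_zero_sum_mats:
  assumes V_eq: "V = annihilated_mats n k a" and nonzero: "\<exists>i\<in>{1..n}. a i \<noteq> 0"
  shows "V = annihilated_mats n k (\<lambda>_. 1)"
proof -
  have const: "a i = a 1" if "i \<in> {1..n}" for i
    using that
  proof (induction i)
    case (Suc i)
    then show ?case using adjacent_coefficients_eq[OF V_eq, of i] by (cases "i = 0") auto
  qed simp
  then have "row_comb n a X j = a 1 * row_comb n (\<lambda>_. 1) X j" for X :: "nat \<Rightarrow> nat \<Rightarrow> 'a" and j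
    unfolding row_comb_def sum_distrib_left by (intro sum.cong refl) (simp only: const mult_1)
  moreover have "a 1 \<noteq> 0" using nonzero const by metis
  ultimately show ?thesis by (simp add: V_eq annihilated_mats_def)
qed

lemma base_point_in_zero_sum_mats:
  assumes V_eq: "V = annihilated_mats n k (\<lambda>_. 1)"
  shows "s \<in> V"
proof -
  have "row_comb n (\<lambda>_. 1) s j = 0" if j: "j \<in> {1..k}" for j
  proof -
    define y where "y m = row_comb n (\<lambda>_. 1) s m - (if m = j then 0 else 1)" for m
    define X where "X r m = (if r \<in> {1..k} \<and> m \<in> {1..k} then
        if r = j then y m else if r = m then 1 else 0 else 0)" for r m
    have "X \<in> mat_space n k" using enough_rows by (auto simp: X_def mat_space_def)
    moreover have "row_comb n (\<lambda>_. 1) X m = row_comb n (\<lambda>_. 1) s m" if m: "m \<in> {1..k}" for m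
    proof -
      have "row_comb n (\<lambda>_. 1) X m =
          (\<Sum>r=1..n. (if r = j then y m else 0) + (if r = m then (if m = j then 0 else 1) else 0))"
        unfolding row_comb_def by (rule sum.cong) (use m j in \<open>auto simp: X_def\<close>)
      then show ?thesis using m j enough_rows by (simp add: sum.distrib y_def)
    qed
    ultimately have "0 = maximal_minor_sum n k X"
      using maximal_minor_sum_eq_0_if_row_comb_eq[OF V_eq] by simp
    also have "\<dots> = det_k k X"
      by (rule maximal_minor_sum_eq_det_k) (use enough_rows in \<open>auto simp: X_def\<close>)
    also have "\<dots> = det_k k (\<lambda>r m. if r = j then y m else if r = m then 1 else 0)"
      by (rule det_k_cong) (auto simp: X_def)
    also have "\<dots> = y j" by (rule det_k_identity_replace_row[OF j])
    finally show ?thesis by (simp add: y_def)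
  qed
  then show ?thesis using s by (simp add: V_eq annihilated_mats_def)
qed

lemma odd_columns:
  assumes V_eq: "V = annihilated_mats n k (\<lambda>_. 1)"
  shows "odd k"
proof
  assume "even k"
  moreover have "k < n" using enough_rows by simp
  ultimately obtain X where X: "X \<in> annihilated_mats n k (\<lambda>_. 1 :: 'a)"
    and X_1: "maximal_minor_sum n k X = 1"
    by (rule maximal_minor_sum_even_ne_0) blast
  then have "X - s \<in> V"
    using base_point_in_zero_sum_mats[OF V_eq] mat.subspace_diff[OF subspace] by (simp add: V_eq)
  then show False using X_1 maximal_minor_sum_eq_0_if_diff_mem by simp
qed

end

text \<open>The step of an induction on the number of columns; \<open>rigid\<close> is the induction hypothesis.\<close>

locale vanishing_coset_step = vanishing_coset "Suc m" "Suc k" s V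
  for m k :: nat and s :: "nat \<Rightarrow> nat \<Rightarrow> 'a::field" and V :: "(nat \<Rightarrow> nat \<Rightarrow> 'a) set" +
  assumes rigid: "\<And>s' V'. vanishing_coset m k s' V' \<Longrightarrow>
    odd k \<and> V' = annihilated_mats m k (\<lambda>_. 1 :: 'a) \<and> s' \<in> V'"
begin

definition last_column_attained :: "nat \<Rightarrow> bool" where
  "last_column_attained i \<longleftrightarrow>
    (\<exists>v\<in>V. \<forall>r\<in>{1..Suc m}. (s + v) r (Suc k) = (if r = i then 1 else 0))"

lemma ex_unit_mat_notin:
  assumes "last_column_attained 1"
  shows "\<exists>i\<in>{1..Suc m}. \<exists>j\<in>{1..k}. unit_mat i j \<notin> V"
proof (rule ccontr)
  assume "\<not> ?thesis"
  then have "unit_mats ({1..Suc m} \<times> {1..k}) \<subseteq> V" by (auto simp: unit_mats_def)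
  then have mat_space_V: "mat_space (Suc m) k \<subseteq> V"
    unfolding span_unit_mats[symmetric] by (rule mat.span_minimal[OF _ subspace])
  obtain v where v: "v \<in> V"
    and last_column: "\<And>r. r \<in> {1..Suc m} \<Longrightarrow> (s + v) r (Suc k) = (if r = 1 then 1 else 0)"
    using assms unfolding last_column_attained_def by blast
  define X where "X r c = (if c = Suc k then (s + v) r c
    else if c \<in> {1..k} \<and> r = Suc c then 1 else 0)" for r c
  have "X - (s + v) \<in> mat_space (Suc m) k"
    using mat_spaceD[OF add_in_mat_space[OF v]] enough_rows by (auto simp: mat_space_def X_def)
  then have "X - (s + v) + v \<in> V"
    using mat_space_V v by (intro mat.subspace_add[OF subspace]) auto
  then have "0 = maximal_minor_sum (Suc m) (Suc k) X"
    using maximal_minor_sum_eq_0_if_diff_mem by (simp add: algebra_simps)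
  also have "\<dots> = (-1) ^ k * X 1 (Suc k) * maximal_minor_sum m k (signed_delete_row 1 X)"
    by (rule maximal_minor_sum_last_column) (use last_column in \<open>auto simp: X_def\<close>)
  also have "maximal_minor_sum m k (signed_delete_row 1 X) =
      maximal_minor_sum m k (\<lambda>r j. if r = j then 1 else 0)"
    by (rule maximal_minor_sum_cong) (auto simp: signed_delete_row_def X_def)
  also have "\<dots> = 1"
    using enough_rows by (intro maximal_minor_sum_identity) auto
  also have "X 1 (Suc k) = 1" using last_column[of 1] by (simp add: X_def)
  finally show False by simp
qed

lemma signed_delete_row_in_zero_sum_mats:
  assumes "last_column_attained i" and i: "i \<in> {1..Suc m}" and j: "j \<in> {1..k}"
    and pivot: "unit_mat i j \<notin> V"
  shows "odd k" and "w \<in> V \<inter> mat_space (Suc m) k \<Longrightarrow> l \<in> {1..k} \<Longrightarrow>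
    row_comb m (\<lambda>_. 1) (signed_delete_row i w) l = 0"
proof -
  obtain v where v: "v \<in> V"
    and last_column: "\<And>r. r \<in> {1..Suc m} \<Longrightarrow> (s + v) r (Suc k) = (if r = i then 1 else 0)"
    using assms(1) unfolding last_column_attained_def by blast
  have "vanishing_coset m k (signed_delete_row i (s + v))
      (signed_delete_row i ` (V \<inter> mat_space (Suc m) k))"
    by (rule vanishing_coset_signed_delete_row[OF vanishing_coset_axioms i j pivot v last_column])
  note zero_sum = rigid[OF this]
  then show "odd k" by blast
  assume "w \<in> V \<inter> mat_space (Suc m) k" and l: "l \<in> {1..k}"
  then have "signed_delete_row i w \<in> annihilated_mats m k (\<lambda>_. 1)" using zero_sum by blast
  then show "row_comb m (\<lambda>_. 1) (signed_delete_row i w) l = 0"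
    using l by (simp add: annihilated_mats_def)
qed

lemma alternating_if_last_columns_attained:
  assumes attained: "\<forall>i\<in>{1..Suc m}. last_column_attained i"
  shows "odd k" and "w \<in> V \<inter> mat_space (Suc m) k \<Longrightarrow> i \<in> {1..m} \<Longrightarrow> l \<in> {1..k} \<Longrightarrow>
    w (Suc i) l = - w i l"
proof -
  obtain q j where q: "q \<in> {1..Suc m}" and j: "j \<in> {1..k}" and q_pivot: "unit_mat q j \<notin> V"
    using ex_unit_mat_notin attained by auto
  note at_q = signed_delete_row_in_zero_sum_mats[OF bspec[OF attained q] q j q_pivot]
  show "odd k" by (rule at_q(1))
  have pivot: "unit_mat i j \<notin> V" if i: "i \<in> {1..Suc m}" for i
  proof
    assume mem: "unit_mat i j \<in> V"
    then have "i \<noteq> q" using q_pivot by blast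
    have "row_comb m (\<lambda>_. 1) (signed_delete_row q (unit_mat i j)) j = (0 :: 'a)"
      using mem i j by (intro at_q(2)) (auto intro: unit_mat_in_mat_space)
    then show False
      using row_comb_signed_delete_row_unit_mat[OF q i \<open>i \<noteq> q\<close>, where 'a = 'a]
      by (simp split: if_splits)
  qed
  assume w: "w \<in> V \<inter> mat_space (Suc m) k" and i: "i \<in> {1..m}" and l: "l \<in> {1..k}"
  have "row_comb m (\<lambda>_. 1) (signed_delete_row r w) l = 0" if "r \<in> {1..Suc m}" for r
    using signed_delete_row_in_zero_sum_mats(2)[OF bspec[OF attained that] that j pivot[OF that]]
      w l by blast
  then have "w i l + w (Suc i) l = 0"
    using row_comb_signed_delete_row_diff[OF i, of w l] i by simp
  then show "w (Suc i) l = - w i l" by (simp add: eq_neg_iff_add_eq_0 add.commute)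
qed

lemma ex_last_column_not_attained: "\<exists>i\<in>{1..Suc m}. \<not> last_column_attained i"
proof (rule ccontr)
  assume "\<not> ?thesis"
  then have "\<forall>i\<in>{1..Suc m}. last_column_attained i" by blast
  note alternating = alternating_if_last_columns_attained[OF this]
  let ?A = "{2..Suc m} \<times> {1..k}"
  have "1 \<le> k" using alternating(1) by (cases k) auto
  have "Suc k < (k + 2) * 1" by simp
  also have "\<dots> \<le> m * k"
    using enough_rows \<open>1 \<le> k\<close> by (intro mult_le_mono) auto
  finally have "Suc k < card (unit_mats ?A :: (nat \<Rightarrow> nat \<Rightarrow> 'a) set)"
    unfolding card_unit_mats by (simp add: card_cartesian_product)
  moreover have A_subset: "unit_mats ?A \<subseteq> (mat_space (Suc m) k :: (nat \<Rightarrow> nat \<Rightarrow> 'a) set)"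
    by (rule unit_mats_subset_mat_space) auto
  ultimately obtain c where c: "\<exists>x\<in>unit_mats ?A. c x \<noteq> 0"
    and mem: "(\<Sum>x\<in>unit_mats ?A. mscale (c x) x) \<in> V"
    using codim_leE[OF codim finite_unit_mats[of ?A]] mat_space_subset_Suc by blast
  define w where "w = (\<Sum>x\<in>unit_mats ?A. mscale (c x) x)"
  have w_apply: "w r l = (if (r, l) \<in> ?A then c (unit_mat r l) else 0)" for r l
    unfolding w_def by (rule sum_unit_mats_apply) simp
  have "w \<in> V \<inter> mat_space (Suc m) k"
    unfolding w_def using mem A_subset
    by (intro IntI mat.subspace_sum[OF subspace_mat_space] mat_space_scale) auto
  note alternating_w = alternating(2)[OF this]
  have w_0: "r \<in> {1..Suc m} \<Longrightarrow> l \<in> {1..k} \<Longrightarrow> w r l = 0" for r l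
  proof (induction r)
    case (Suc r)
    then show ?case using alternating_w[of r l] w_apply[of 1 l] by (cases "r = 0") auto
  qed simp
  have "c x = 0" if mem_units: "x \<in> unit_mats ?A" for x
  proof -
    obtain r l where x: "x = unit_mat r l" "(r, l) \<in> ?A"
      using mem_units by (auto simp: unit_mats_def)
    then have "c x = w r l" by (simp only: w_apply if_True)
    also have "\<dots> = 0" using x(2) by (intro w_0) auto
    finally show ?thesis .
  qed
  with c show False by blast
qed

lemma last_column_annihilator:
  "\<exists>a. (\<exists>i\<in>{1..Suc m}. a i \<noteq> 0) \<and> (\<forall>v\<in>V. row_comb (Suc m) a v (Suc k) = 0)"
proof -
  interpret column: Vector_Spaces.linear mscale fun_scale "\<lambda>X :: nat \<Rightarrow> nat \<Rightarrow> 'a. \<lambda>r. X r (Suc k)"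
    by unfold_locales (auto simp: mscale_def fun_scale_def)
  obtain i where i: "i \<in> {1..Suc m}" "\<not> last_column_attained i"
    using ex_last_column_not_attained by blast
  let ?U = "(\<lambda>v r. v r (Suc k)) ` V"
  define e where "e r = (if r = i then 1 else 0) - s r (Suc k)" for r
  have e_notin: "e \<notin> ?U"
  proof
    assume "e \<in> ?U"
    then obtain v where v: "v \<in> V" "e = (\<lambda>r. v r (Suc k))" by blast
    have "(s + v) r (Suc k) = (if r = i then 1 else 0)" for r
      using fun_cong[OF v(2), of r] by (simp add: e_def algebra_simps)
    then show False using i(2) v(1) unfolding last_column_attained_def by blast
  qed
  have U_support: "\<forall>u\<in>?U. \<forall>r. r \<notin> {1..Suc m} \<longrightarrow> u r = 0"
    using V mat_spaceD by blast
  have e_support: "\<forall>r. r \<notin> {1..Suc m} \<longrightarrow> e r = 0"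
    using i(1) mat_spaceD[OF s] by (auto simp: e_def)
  obtain a where "\<exists>i\<in>{1..Suc m}. a i \<noteq> 0"
    and "\<And>u. u \<in> ?U \<Longrightarrow> (\<Sum>r=1..Suc m. a r * u r) = 0"
    by (rule subspace_annihilator[OF finite_atLeastAtMost column.subspace_image[OF subspace]
        U_support e_notin e_support]) blast
  then show ?thesis unfolding row_comb_def by blast
qed

lemma column_combination_annihilator:
  assumes j: "j \<in> {1..Suc k}" and w: "w j \<noteq> 0"
  shows "\<exists>a. (\<exists>i\<in>{1..Suc m}. a i \<noteq> 0) \<and>
    (\<forall>v\<in>V. (\<Sum>l=1..Suc k. w l * row_comb (Suc m) a v l) = 0)"
proof -
  let ?mix = "mix_columns (Suc k) j w :: (nat \<Rightarrow> nat \<Rightarrow> 'a) \<Rightarrow> nat \<Rightarrow> nat \<Rightarrow> 'a"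
  have "vanishing_coset (Suc m) (Suc k) (?mix s) (?mix ` V)"
  proof (rule vanishing_coset_image[OF linear_mix_columns])
    show "?mix ` mat_space (Suc m) (Suc k) = mat_space (Suc m) (Suc k)"
      using j w by (rule mix_columns_image_mat_space)
    show "maximal_minor_sum (Suc m) (Suc k) (?mix X) = 0"
      if "maximal_minor_sum (Suc m) (Suc k) X = 0" for X
      using that maximal_minor_sum_mix_columns[OF j, of "Suc m" w] by auto
  qed
  then interpret mix: vanishing_coset_step m k "?mix s" "?mix ` V"
    using rigid by (simp add: vanishing_coset_step_def vanishing_coset_step_axioms_def)
  from mix.last_column_annihilator show ?thesis
    by (simp only: ball_simps row_comb_mix_columns)
qed

lemma ex_column_annihilator:
  assumes l: "l \<in> {1..Suc k}"
  shows "\<exists>a. (\<exists>i\<in>{1..Suc m}. a i \<noteq> 0) \<and> (\<forall>v\<in>V. row_comb (Suc m) a v l = 0)"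
proof -
  let ?e = "\<lambda>c. if c = l then 1 else 0 :: 'a"
  have "(\<Sum>c=1..Suc k. ?e c * row_comb (Suc m) a v c) = row_comb (Suc m) a v l" for a v
  proof -
    have "(\<Sum>c=1..Suc k. ?e c * row_comb (Suc m) a v c) =
        (\<Sum>c=1..Suc k. if c = l then row_comb (Suc m) a v l else 0)"
      by (rule sum.cong) auto
    then show ?thesis using l by (simp del: sum.cl_ivl_Suc)
  qed
  then show ?thesis using column_combination_annihilator[OF l, of ?e] by simp
qed

lemma direction_eq_annihilated_mats:
  obtains a where "\<exists>i\<in>{1..Suc m}. a i \<noteq> 0" "V = annihilated_mats (Suc m) (Suc k) a"
proof -
  obtain a where a: "\<And>l. l \<in> {1..Suc k} \<Longrightarrow> \<exists>i\<in>{1..Suc m}. a l i \<noteq> 0"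
    and "\<And>l v. l \<in> {1..Suc k} \<Longrightarrow> v \<in> V \<Longrightarrow> row_comb (Suc m) (a l) v l = 0"
    using ex_column_annihilator by metis
  then have V_eq:
    "V = {X \<in> mat_space (Suc m) (Suc k). \<forall>l\<in>{1..Suc k}. row_comb (Suc m) (a l) X l = 0}"
    by (rule direction_eq_if_column_annihilators)
  obtain b where b: "\<exists>i\<in>{1..Suc m}. b i \<noteq> 0"
    and b_V: "\<And>v. v \<in> V \<Longrightarrow> (\<Sum>c=1..Suc k. 1 * row_comb (Suc m) b v c) = 0"
    using column_combination_annihilator[of 1 "\<lambda>_. 1"] by auto
  have "row_comb (Suc m) (a l) X l = 0 \<longleftrightarrow> row_comb (Suc m) b X l = 0" if l: "l \<in> {1..Suc k}" for l X
  proof -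
    obtain \<mu> where \<mu>: "\<mu> \<noteq> 0" "\<And>i. i \<in> {1..Suc m} \<Longrightarrow> b i = \<mu> * a l i"
      by (rule proportional_to_column_annihilator[OF V_eq l a[OF l] b _ b_V]) auto
    have "row_comb (Suc m) b X l = \<mu> * row_comb (Suc m) (a l) X l"
      unfolding row_comb_def sum_distrib_left by (rule sum.cong) (use \<mu>(2) in auto)
    then show ?thesis using \<mu>(1) by simp
  qed
  then have "V = annihilated_mats (Suc m) (Suc k) b"
    unfolding V_eq annihilated_mats_def by blast
  with b show thesis by (rule that)
qed

end

lemma vanishing_coset_zero_sum:
  assumes "vanishing_coset n k s V"
  shows "odd k \<and> V = annihilated_mats n k (\<lambda>_. 1) \<and> s \<in> V"
  using assms
proof (induction k arbitrary: n s V)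
  case 0
  then interpret vanishing_coset n 0 s V .
  have "maximal_minor_sum n 0 s = 1"
    by (subst maximal_minor_sum_eq_det_k) (auto simp: det_k_def)
  then show ?case using vanish[OF mat.subspace_0[OF subspace]] by simp
next
  case (Suc k)
  interpret vanishing_coset n "Suc k" s V by (rule Suc.prems)
  obtain m where n: "n = Suc m" using enough_rows by (cases n) auto
  interpret step: vanishing_coset_step m k s V
    using Suc unfolding n vanishing_coset_step_def vanishing_coset_step_axioms_def by blast
  obtain a where "\<exists>i\<in>{1..n}. a i \<noteq> 0" "V = annihilated_mats n (Suc k) a"
    unfolding n by (rule step.direction_eq_annihilated_mats)
  then have "V = annihilated_mats n (Suc k) (\<lambda>_. 1)"
    by (intro direction_eq_zero_sum_mats)
  then show ?case using odd_columns base_point_in_zero_sum_mats by blast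
qed

lemma vanishing_coset_alternate_rows:
  fixes V :: "(nat \<Rightarrow> nat \<Rightarrow> 'a::field) set"
  assumes "k + 2 \<le> n" and "s \<in> mat_space n k" and V: "mat.subspace V" "V \<subseteq> mat_space n k"
    and codim: "codim_le mscale (mat_space n k) V k"
    and vanish: "\<And>v. v \<in> V \<Longrightarrow> cullis_det n k (s + v) = 0"
  shows "vanishing_coset n k (alternate_rows s) (alternate_rows ` V)"
proof
  note linear = linear_alternate_rows[where 'a = 'a]
  have "mat_space n k \<subseteq> alternate_rows ` (mat_space n k :: (nat \<Rightarrow> nat \<Rightarrow> 'a) set)"
    by (metis alternate_rows_alternate_rows alternate_rows_in_mat_space_iff image_eqI subsetI)
  then show "codim_le mscale (mat_space n k) (alternate_rows ` V) k"
    by (rule mat_endo.codim_le_image[OF linear _ codim])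
  show "mat.subspace (alternate_rows ` V)" by (rule mat_endo.linear_subspace_image[OF linear V(1)])
  fix w assume "w \<in> alternate_rows ` V"
  then obtain v where "v \<in> V" "w = alternate_rows v" by blast
  then show "maximal_minor_sum n k (alternate_rows s + w) = 0"
    using vanish
    by (simp only: mat_endo.linear_add[OF linear, symmetric] cullis_det_eq_0_iff[symmetric])
qed (use assms in \<open>auto simp: alternate_rows_in_mat_space_iff\<close>)

lemma linear_variety_eq_if_cullis_det_eq_0:
  fixes K :: "(nat \<Rightarrow> nat \<Rightarrow> 'a::field) set"
  assumes n: "k + 2 \<le> n" and K: "linear_variety n k K" and codim: "variety_codim n k K \<le> k"
    and vanish: "\<And>X. X \<in> K \<Longrightarrow> cullis_det n k X = 0"
  shows "odd k \<and> K = annihilated_mats n k (\<lambda>i. (-1) ^ i)"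
proof -
  obtain s V where s: "s \<in> mat_space n k" and V: "mat.subspace V" "V \<subseteq> mat_space n k"
    and K_eq: "K = (\<lambda>v. s + v) ` V"
    using K unfolding linear_variety_def by blast
  have "codim_le mscale (mat_space n k) V k"
    using codim codim_le_mono[OF codim_le_mat_space[OF V]]
    by (simp add: variety_codim_def K_eq direction_translate[OF V(1)])
  then have "vanishing_coset n k (alternate_rows s) (alternate_rows ` V)"
    using vanish by (intro vanishing_coset_alternate_rows n s V) (auto simp: K_eq)
  then have "odd k" and alt_V: "alternate_rows ` V = annihilated_mats n k (\<lambda>_. 1)"
    and alt_s: "alternate_rows s \<in> alternate_rows ` V"
    using vanishing_coset_zero_sum by blast+
  have "X \<in> V \<longleftrightarrow> alternate_rows X \<in> alternate_rows ` V" for X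
    by (metis alternate_rows_alternate_rows imageE image_eqI)
  then have "V = annihilated_mats n k (\<lambda>i. (-1) ^ i)" and "s \<in> V"
    using alt_s by (auto simp: alt_V alternate_rows_in_annihilated_mats_iff)
  with \<open>odd k\<close> translate_eq_if_mem[OF V(1)] K_eq show ?thesis by blast
qed

lemma cullis_det_eq_0_if_annihilated:
  assumes "odd k" and "X \<in> annihilated_mats n k (\<lambda>i. (-1) ^ i)"
  shows "cullis_det n k X = 0"
  unfolding cullis_det_eq_0_iff
  by (rule maximal_minor_sum_odd_eq_0)
    (use assms in \<open>simp_all add: alternate_rows_in_annihilated_mats_iff\<close>)

lemma variety_codim_annihilated_mats:
  fixes a :: "nat \<Rightarrow> 'a::field"
  assumes "0 < n" and "a n \<noteq> 0"
  shows "variety_codim n k (annihilated_mats n k a) = k"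
proof -
  obtain m where n: "n = Suc m" using assms(1) by (cases n) auto
  have "direction (annihilated_mats n k a) = annihilated_mats n k a"
    using direction_translate[OF subspace_annihilated_mats, of 0 n k a] by simp
  moreover have "mat.dim (annihilated_mats n k a) = m * k"
    unfolding n using assms(2) by (intro dim_annihilated_mats) (simp add: n)
  ultimately show ?thesis by (simp add: variety_codim_def n)
qed

theorem mainTheorem1:
  fixes K :: "(nat \<Rightarrow> nat \<Rightarrow> 'a::field) set" and n k :: nat
  assumes "0 < k" and "k + 2 \<le> n" and "linear_variety n k K"
  shows "((\<forall>X\<in>K. cullis_det n k X = 0) \<and> variety_codim n k K = k) \<longleftrightarrow>
         (odd k \<and> K = {X \<in> mat_space n k. \<forall>j\<in>{1..k}. (\<Sum>i=1..n. (-1) ^ i * X i j) = 0})"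
proof -
  have annihilated: "{X \<in> mat_space n k. \<forall>j\<in>{1..k}. (\<Sum>i=1..n. (-1) ^ i * X i j) = 0} =
      annihilated_mats n k (\<lambda>i. (-1 :: 'a) ^ i)"
    by (simp add: annihilated_mats_def row_comb_def)
  show ?thesis
    unfolding annihilated
  proof
    assume "(\<forall>X\<in>K. cullis_det n k X = 0) \<and> variety_codim n k K = k"
    then show "odd k \<and> K = annihilated_mats n k (\<lambda>i. (-1) ^ i)"
      using linear_variety_eq_if_cullis_det_eq_0[OF assms(2,3)] by simp
  next
    assume K: "odd k \<and> K = annihilated_mats n k (\<lambda>i. (-1) ^ i)"
    have "variety_codim n k (annihilated_mats n k (\<lambda>i. (-1 :: 'a) ^ i)) = k"
      using assms(2) by (intro variety_codim_annihilated_mats) auto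
    with K show "(\<forall>X\<in>K. cullis_det n k X = 0) \<and> variety_codim n k K = k"
      using cullis_det_eq_0_if_annihilated by blast
  qed
qed

end
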